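(* Suppose that $(\Pi,\alpha_q)$ is a Hermitian pair of tube type (equivalently, that the associated involution $\sigma$ is a Hermitian involution of tube type). Then there exists a unique antichain $\mathcal A_*\in\mathrm{Ort}_{\max}(\Phi_1^+)$, and $\mathcal A_*\vdash\mathcal B$ for all $\mathcal B\in\mathrm{Ort}_{\max}(\Phi_1^+)$.
   Context: $\mathfrak g$ is a complex simple Lie algebra with root system $\Phi$, $\Pi$ a set of simple roots with positive system $\Phi^+$, $\theta$ the highest root, and $[\beta:\alpha]$ denotes the coefficient of $\alpha\in\Pi$ in $\beta$. A Hermitian pair $(\Pi,\alpha_q)$ consists of $\Pi$ and a simple root $\alpha_q\in\Pi$ with $[\theta:\alpha_q]=1$. Put $\Phi_0=\{\beta\in\Phi:[\beta:\alpha_q]=0\}$, $\Phi_0^+=\Phi_0\cap\Phi^+$, $\Phi_1^+=\{\beta\in\Phi^+:[\beta:\alpha_q]=1\}$. The associated (Hermitian) involution $\sigma$ of $\mathfrak g$ is $+1$ on the Levi subalgebra with roots $\Phi_0$ and $-1$ on the root spaces of $\Phi_1^+\cup-\Phi_1^+$. The pair, and $\sigma$, are of tube type if $w(\alpha_q)=-\alpha_q$, where $w$ is the longest element of the Weyl group of $\mathfrak g$; the cases (Bourbaki numbering) are $(A_{2q-1},\alpha_q)$, $(B_n,\alpha_1)$, $(C_n,\alpha_n)$, $(D_n,\alpha_{n-1})$ and $(D_n,\alpha_n)$ with $n$ even, $(D_n,\alpha_1)$, $(E_7,\alpha_7)$. The order $\le_0$ is: $\lambda\le_0\mu$ iff $\mu-\lambda\in\mathbb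 N\Phi_0^+$; antichains in $\Phi_1^+$ are taken with respect to $\le_0$. $\mathrm{Ort}(\Phi_1^+)$ is the collection of subsets of $\Phi_1^+$ with pairwise orthogonal elements, and $\mathrm{Ort}_{\max}(\Phi_1^+)$ is the collection of those maximal with respect to inclusion. For $\mathcal B_1,\mathcal B_2\in\mathrm{Ort}(\Phi_1^+)$, $\mathcal B_1\vdash\mathcal B_2$ means: for every $\alpha\in\mathcal B_1$ there is $\beta\in\mathcal B_2$ with $\beta\le_0\alpha$. *)

theory Defs
  imports "HOL-Analysis.Analysis"
begin

section \<open>Root systems\<close>

text \<open>The set Pi of simple roots is written \<open>\<Delta>\<close>, since \<open>\<Pi>\<close> is reserved syntax.\<close>

definition reflection :: "'a::real_inner \<Rightarrow> 'a \<Rightarrow> 'a" where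
  "reflection \<alpha> x = x - (2 * (x \<bullet> \<alpha>) / (\<alpha> \<bullet> \<alpha>)) *\<^sub>R \<alpha>"

text \<open>Reduced crystallographic root systems. The inner product of the ambient Euclidean space is
  invariant under the Weyl group, because the maps \<open>reflection \<alpha>\<close> are isometries.\<close>

definition root_system :: "'a::euclidean_space set \<Rightarrow> bool" where
  "root_system \<Phi> \<longleftrightarrow>
     finite \<Phi> \<and> 0 \<notin> \<Phi> \<and> span \<Phi> = UNIV \<and>
     (\<forall>\<alpha>\<in>\<Phi>. reflection \<alpha> ` \<Phi> = \<Phi>) \<and>
     (\<forall>\<alpha>\<in>\<Phi>. \<forall>\<beta>\<in>\<Phi>. 2 * (\<beta> \<bullet> \<alpha>) / (\<alpha> \<bullet> \<alpha>) \<in> \<int>) \<and>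
     (\<forall>\<alpha>\<in>\<Phi>. \<forall>c. c *\<^sub>R \<alpha> \<in> \<Phi> \<longrightarrow> c = 1 \<or> c = -1)"

text \<open>The irreducible root systems are exactly the root systems of the complex simple Lie
  algebras.\<close>

definition irreducible_root_system :: "'a::euclidean_space set \<Rightarrow> bool" where
  "irreducible_root_system \<Phi> \<longleftrightarrow>
     root_system \<Phi> \<and> \<Phi> \<noteq> {} \<and>
     \<not> (\<exists>A B. A \<noteq> {} \<and> B \<noteq> {} \<and> A \<inter> B = {} \<and> A \<union> B = \<Phi> \<and>
              (\<forall>a\<in>A. \<forall>b\<in>B. orthogonal a b))"

text \<open>The set \<open>\<nat>S\<close>; it is only used for finite \<open>S\<close>. In particular \<open>nat_combinations {} = {0}\<close>.\<close>

definition nat_combinations :: "'a::real_vector set \<Rightarrow> 'a set" where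
  "nat_combinations S = {v. \<exists>c :: 'a \<Rightarrow> nat. v = (\<Sum>\<beta>\<in>S. real (c \<beta>) *\<^sub>R \<beta>)}"

definition simple_roots :: "'a::euclidean_space set \<Rightarrow> 'a set \<Rightarrow> bool" where
  "simple_roots \<Phi> \<Delta> \<longleftrightarrow>
     \<Delta> \<subseteq> \<Phi> \<and> independent \<Delta> \<and>
     (\<forall>\<beta>\<in>\<Phi>. \<beta> \<in> nat_combinations \<Delta> \<or> - \<beta> \<in> nat_combinations \<Delta>)"

definition positive_roots :: "'a::euclidean_space set \<Rightarrow> 'a set \<Rightarrow> 'a set" where
  "positive_roots \<Phi> \<Delta> = \<Phi> \<inter> nat_combinations \<Delta>"

definition highest_root :: "'a::euclidean_space set \<Rightarrow> 'a set \<Rightarrow> 'a \<Rightarrow> bool" where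
  "highest_root \<Phi> \<Delta> \<theta> \<longleftrightarrow> \<theta> \<in> \<Phi> \<and> (\<forall>\<beta>\<in>\<Phi>. \<theta> - \<beta> \<in> nat_combinations \<Delta>)"

definition word_product :: "'a::real_inner list \<Rightarrow> 'a \<Rightarrow> 'a" where
  "word_product \<alpha>s = foldr (\<lambda>\<alpha> f. reflection \<alpha> \<circ> f) \<alpha>s id"

text \<open>Reflections are involutions, so words without inverses already form a group.\<close>

definition weyl_group :: "'a::euclidean_space set \<Rightarrow> ('a \<Rightarrow> 'a) set" where
  "weyl_group \<Phi> = {word_product \<alpha>s |\<alpha>s. set \<alpha>s \<subseteq> \<Phi>}"

definition weyl_length :: "'a::euclidean_space set \<Rightarrow> ('a \<Rightarrow> 'a) \<Rightarrow> nat" where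
  "weyl_length \<Delta> w = (LEAST n. \<exists>\<alpha>s. set \<alpha>s \<subseteq> \<Delta> \<and> length \<alpha>s = n \<and> word_product \<alpha>s = w)"

definition longest_element :: "'a::euclidean_space set \<Rightarrow> 'a set \<Rightarrow> ('a \<Rightarrow> 'a) \<Rightarrow> bool" where
  "longest_element \<Phi> \<Delta> w \<longleftrightarrow>
     w \<in> weyl_group \<Phi> \<and> (\<forall>v\<in>weyl_group \<Phi>. weyl_length \<Delta> v \<le> weyl_length \<Delta> w)"

section \<open>Hermitian pairs\<close>

text \<open>The coefficient \<open>[\<beta>:\<alpha>]\<close> is \<open>representation \<Delta> \<beta> \<alpha>\<close>.\<close>

definition hermitian_pair :: "'a::euclidean_space set \<Rightarrow> 'a set \<Rightarrow> 'a \<Rightarrow> bool" where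
  "hermitian_pair \<Phi> \<Delta> \<alpha>q \<longleftrightarrow>
     simple_roots \<Phi> \<Delta> \<and> \<alpha>q \<in> \<Delta> \<and> (\<exists>\<theta>. highest_root \<Phi> \<Delta> \<theta> \<and> representation \<Delta> \<theta> \<alpha>q = 1)"

definition tube_type :: "'a::euclidean_space set \<Rightarrow> 'a set \<Rightarrow> 'a \<Rightarrow> bool" where
  "tube_type \<Phi> \<Delta> \<alpha>q \<longleftrightarrow> (\<exists>w. longest_element \<Phi> \<Delta> w \<and> w \<alpha>q = - \<alpha>q)"

definition Phi0_pos :: "'a::euclidean_space set \<Rightarrow> 'a set \<Rightarrow> 'a \<Rightarrow> 'a set" where
  "Phi0_pos \<Phi> \<Delta> \<alpha>q = {\<beta> \<in> positive_roots \<Phi> \<Delta>. representation \<Delta> \<beta> \<alpha>q = 0}"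

definition Phi1_pos :: "'a::euclidean_space set \<Rightarrow> 'a set \<Rightarrow> 'a \<Rightarrow> 'a set" where
  "Phi1_pos \<Phi> \<Delta> \<alpha>q = {\<beta> \<in> positive_roots \<Phi> \<Delta>. representation \<Delta> \<beta> \<alpha>q = 1}"

definition le0 :: "'a::euclidean_space set \<Rightarrow> 'a set \<Rightarrow> 'a \<Rightarrow> 'a \<Rightarrow> 'a \<Rightarrow> bool" where
  "le0 \<Phi> \<Delta> \<alpha>q \<mu> \<nu> \<longleftrightarrow> \<nu> - \<mu> \<in> nat_combinations (Phi0_pos \<Phi> \<Delta> \<alpha>q)"

definition antichain0 :: "'a::euclidean_space set \<Rightarrow> 'a set \<Rightarrow> 'a \<Rightarrow> 'a set \<Rightarrow> bool" where
  "antichain0 \<Phi> \<Delta> \<alpha>q A \<longleftrightarrow> (\<forall>\<mu>\<in>A. \<forall>\<nu>\<in>A. le0 \<Phi> \<Delta> \<alpha>q \<mu> \<nu> \<longrightarrow> \<mu> = \<nu>)"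

definition Ort :: "'a::euclidean_space set \<Rightarrow> 'a set set" where
  "Ort S = {B. B \<subseteq> S \<and> pairwise orthogonal B}"

definition Ort_max :: "'a::euclidean_space set \<Rightarrow> 'a set set" where
  "Ort_max S = {B \<in> Ort S. \<forall>C\<in>Ort S. B \<subseteq> C \<longrightarrow> B = C}"

text \<open>The relation \<open>B\<^sub>1 \<turnstile> B\<^sub>2\<close>.\<close>

definition ort_entails :: "'a::euclidean_space set \<Rightarrow> 'a set \<Rightarrow> 'a \<Rightarrow> 'a set \<Rightarrow> 'a set \<Rightarrow> bool" where
  "ort_entails \<Phi> \<Delta> \<alpha>q B1 B2 \<longleftrightarrow> (\<forall>\<alpha>\<in>B1. \<exists>\<beta>\<in>B2. le0 \<Phi> \<Delta> \<alpha>q \<beta> \<alpha>)"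

end

(* Idea. Let omega be the coweight dual to alpha_q and, for a set B of orthogonal roots in Phi_1^+,
let s_B be the product of the reflections in B.

Tube type gives w omega = - omega for the longest element w. If B is maximal orthogonal, then
s_B omega is nonpositive on Phi_1^+; after moving B by the Weyl group of Phi_0 to make s_B omega
antidominant, uniqueness of the dominant element of an orbit yields s_B omega = - omega, i.e. the
coroots of B sum to 2 omega. Hence s_B preserves Phi_0 and exchanges Phi_1^+ with - Phi_1^+, and a
root c of Phi_0 is either orthogonal to B or meets exactly two elements a, b of B, with Cartan
integers -1 and 1, so that s_B c = c + a - b.

If B is an antichain this forces s_B to preserve Phi_0^+, so - s_B is an order-reversing involution
of Phi_1^+ fixing B; composing two such involutions shows that there is at most one antichain. If B
is not an antichain, some c in Phi_0^+ has s_B c = - d with d in Phi_0^+, so b = a + c + d, and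
{a, b} can be exchanged for one or two orthogonal roots strictly above a. Iterating reaches an
antichain that entails B. *)

theory Submission
  imports Defs
begin

section \<open>Reflections\<close>

text \<open>The pairing of \<open>x\<close> with the coroot of \<open>\<alpha>\<close>, an integer
  when both belong to a root system; linear in \<open>x\<close> only.\<close>

definition cartan :: "'a::real_inner \<Rightarrow> 'a \<Rightarrow> real" where
  "cartan x \<alpha> = 2 * (x \<bullet> \<alpha>) / (\<alpha> \<bullet> \<alpha>)"

lemma reflection_cartan: "reflection \<alpha> x = x - cartan x \<alpha> *\<^sub>R \<alpha>"
  by (simp add: reflection_def cartan_def)

lemma cartan_add [simp]: "cartan (x + y) \<alpha> = cartan x \<alpha> + cartan y \<alpha>"
  by (simp add: cartan_def inner_add_left add_divide_distrib distrib_left)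

lemma cartan_diff [simp]: "cartan (x - y) \<alpha> = cartan x \<alpha> - cartan y \<alpha>"
  by (simp add: cartan_def inner_diff_left diff_divide_distrib right_diff_distrib)

lemma cartan_minus [simp]: "cartan (- x) \<alpha> = - cartan x \<alpha>"
  by (simp add: cartan_def)

lemma cartan_scaleR [simp]: "cartan (c *\<^sub>R x) \<alpha> = c * cartan x \<alpha>"
  by (simp add: cartan_def)

lemma cartan_self: "\<alpha> \<noteq> 0 \<Longrightarrow> cartan \<alpha> \<alpha> = 2"
  by (simp add: cartan_def)

lemma cartan_orthogonal: "orthogonal x \<alpha> \<Longrightarrow> cartan x \<alpha> = 0"
  by (simp add: cartan_def orthogonal_def)

lemma cartan_pos_iff: "\<alpha> \<noteq> 0 \<Longrightarrow> cartan x \<alpha> > 0 \<longleftrightarrow> x \<bullet> \<alpha> > 0"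
  by (simp add: cartan_def zero_less_mult_iff pos_less_divide_eq)

lemma cartan_eq_0_iff: "\<alpha> \<noteq> 0 \<Longrightarrow> cartan x \<alpha> = 0 \<longleftrightarrow> orthogonal x \<alpha>"
  by (simp add: cartan_def orthogonal_def)

lemma cartan_orthogonal_transformation:
  "orthogonal_transformation u \<Longrightarrow> cartan (u x) (u \<alpha>) = cartan x \<alpha>"
  by (simp add: cartan_def orthogonal_transformation_def)

lemma orthogonal_transformation_reflection: "orthogonal_transformation (reflection \<alpha>)"
proof -
  have "linear (reflection \<alpha>)"
    by (rule linearI) (simp_all add: reflection_cartan algebra_simps)
  moreover have "reflection \<alpha> v \<bullet> reflection \<alpha> w = v \<bullet> w" for v w
    by (cases "\<alpha> = 0")
       (simp_all add: reflection_def inner_diff_left inner_diff_right inner_commute divide_simps)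
  ultimately show ?thesis by (simp add: orthogonal_transformation_def)
qed

lemma reflection_reflection [simp]: "reflection \<alpha> (reflection \<alpha> x) = x"
  by (cases "\<alpha> = 0") (simp_all add: reflection_cartan cartan_self)

lemma reflection_self: "\<alpha> \<noteq> 0 \<Longrightarrow> reflection \<alpha> \<alpha> = - \<alpha>"
  by (simp add: reflection_cartan cartan_self scaleR_2)

lemma reflection_uminus_root [simp]: "reflection (- \<alpha>) = reflection \<alpha>"
  by (auto simp: fun_eq_iff reflection_def)

lemma reflection_conj:
  "orthogonal_transformation u \<Longrightarrow> reflection (u \<alpha>) (u x) = u (reflection \<alpha> x)"
  by (simp add: reflection_cartan cartan_orthogonal_transformation linear_diff linear_scale
      orthogonal_transformation_linear)

lemma reflection_fix: "orthogonal x \<alpha> \<Longrightarrow> reflection \<alpha> x = x"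
  by (simp add: reflection_cartan cartan_orthogonal)

text \<open>For pairwise orthogonal \<open>B\<close> this is the product of the commuting
  reflections in \<open>B\<close>. The sum formula is independent of an ordering of \<open>B\<close>
  and shows all Cartan numbers at once.\<close>

definition set_reflection :: "'a::real_inner set \<Rightarrow> 'a \<Rightarrow> 'a" where
  "set_reflection B x = x - (\<Sum>\<beta>\<in>B. cartan x \<beta> *\<^sub>R \<beta>)"

lemma word_product_Nil [simp]: "word_product [] = id"
  and word_product_Cons [simp]: "word_product (\<alpha> # \<alpha>s) = reflection \<alpha> \<circ> word_product \<alpha>s"
  by (simp_all add: word_product_def)

lemma word_product_append: "word_product (xs @ ys) = word_product xs \<circ> word_product ys"
  by (induction xs) auto

lemma orthogonal_transformation_word_product: "orthogonal_transformation (word_product \<alpha>s)"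
proof (induction \<alpha>s)
  case Nil
  show ?case by (simp add: orthogonal_transformation_id id_def)
next
  case (Cons a \<alpha>s)
  then show ?case
    using orthogonal_transformation_compose[OF orthogonal_transformation_reflection]
    by (simp del: o_apply)
qed

text \<open>Places \<open>set_reflection B\<close> in the Weyl group when \<open>B\<close> consists
  of roots. Members of \<open>B\<close> are orthogonal to the new \<open>b\<close>, so applying
  \<open>set_reflection B\<close> leaves the pairing with the coroot of \<open>b\<close>
  unchanged.\<close>

lemma set_reflection_word_product:
  assumes "finite B" "pairwise orthogonal B"
  shows "\<exists>\<alpha>s. set \<alpha>s = B \<and> word_product \<alpha>s = set_reflection B"
  using assms
proof (induction B)
  case empty
  show ?case by (rule exI[of _ "[]"]) (simp add: set_reflection_def fun_eq_iff)
next
  case (insert b B)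
  then obtain \<alpha>s where as: "set \<alpha>s = B" "word_product \<alpha>s = set_reflection B"
    by (auto simp: pairwise_insert)
  have orth: "c \<bullet> b = 0" if "c \<in> B" for c
    using insert.prems insert.hyps that by (auto simp: pairwise_insert orthogonal_def)
  have "cartan (set_reflection B x) b = cartan x b" for x
  proof -
    have "(\<Sum>c\<in>B. cartan x c *\<^sub>R c) \<bullet> b = 0"
      by (simp add: inner_sum_left orth)
    then show ?thesis
      by (simp add: set_reflection_def) (simp add: cartan_def)
  qed
  then have "reflection b (set_reflection B x) = set_reflection (insert b B) x" for x
    using insert.hyps by (simp add: reflection_cartan) (simp add: set_reflection_def)
  then show ?case
    by (intro exI[of _ "b # \<alpha>s"]) (simp add: as fun_eq_iff)
qed

lemma orthogonal_transformation_set_reflection: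
  "finite B \<Longrightarrow> pairwise orthogonal B \<Longrightarrow> orthogonal_transformation (set_reflection B)"
  using set_reflection_word_product orthogonal_transformation_word_product by metis

lemma set_reflection_member:
  assumes "finite B" "pairwise orthogonal B" "\<beta> \<in> B" "\<beta> \<noteq> 0"
  shows "set_reflection B \<beta> = - \<beta>"
proof -
  have "cartan \<beta> \<gamma> *\<^sub>R \<gamma> = (if \<gamma> = \<beta> then 2 *\<^sub>R \<beta> else 0)" if "\<gamma> \<in> B" for \<gamma>
    using assms that cartan_orthogonal[of \<beta> \<gamma>] by (auto simp: cartan_self pairwise_def)
  then have "(\<Sum>\<gamma>\<in>B. cartan \<beta> \<gamma> *\<^sub>R \<gamma>) = 2 *\<^sub>R \<beta>"
    using assms by (simp cong: sum.cong)
  then show ?thesis by (simp add: set_reflection_def scaleR_2)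
qed

text \<open>The vector subtracted from \<open>x\<close> lies in the span of \<open>B\<close>, on
  which the map is -1.\<close>

lemma set_reflection_set_reflection:
  assumes "finite B" "pairwise orthogonal B" "0 \<notin> B"
  shows "set_reflection B (set_reflection B x) = x"
proof -
  have lin: "linear (set_reflection B)"
    using assms orthogonal_transformation_set_reflection orthogonal_transformation_linear by blast
  have "set_reflection B (\<Sum>\<beta>\<in>B. cartan x \<beta> *\<^sub>R \<beta>)
      = (\<Sum>\<beta>\<in>B. cartan x \<beta> *\<^sub>R set_reflection B \<beta>)"
    using lin by (simp add: linear_sum linear_scale)
  also have "\<dots> = (\<Sum>\<beta>\<in>B. - (cartan x \<beta> *\<^sub>R \<beta>))"
    using assms by (intro sum.cong refl) (metis scaleR_minus_right set_reflection_member)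
  finally have "set_reflection B (\<Sum>\<beta>\<in>B. cartan x \<beta> *\<^sub>R \<beta>)
      = - (\<Sum>\<beta>\<in>B. cartan x \<beta> *\<^sub>R \<beta>)"
    by (simp add: sum_negf)
  then have "set_reflection B (x - (\<Sum>\<beta>\<in>B. cartan x \<beta> *\<^sub>R \<beta>)) = x"
    using lin by (simp add: linear_diff) (simp add: set_reflection_def)
  then show ?thesis by (simp add: set_reflection_def[of B x])
qed

text \<open>Used with a Levi reflection as \<open>u\<close>, which fixes \<open>\<omega>\<close>, to
  follow \<open>set_reflection B \<omega>\<close> while \<open>B\<close> is moved.\<close>

lemma set_reflection_image:
  assumes "orthogonal_transformation u"
  shows "set_reflection (u ` B) (u x) = u (set_reflection B x)"
proof -
  have lin: "linear u" and "inj u"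
    using assms orthogonal_transformation_linear orthogonal_transformation_inj by blast+
  then have "(\<Sum>\<beta>\<in>u ` B. cartan (u x) \<beta> *\<^sub>R \<beta>) = (\<Sum>\<beta>\<in>B. cartan (u x) (u \<beta>) *\<^sub>R u \<beta>)"
    by (subst sum.reindex) (auto intro: inj_on_subset)
  also have "\<dots> = u (\<Sum>\<beta>\<in>B. cartan x \<beta> *\<^sub>R \<beta>)"
    using lin assms by (simp add: cartan_orthogonal_transformation linear_sum linear_scale)
  finally show ?thesis using lin by (simp add: set_reflection_def linear_diff)
qed

section \<open>Cones of natural combinations\<close>

lemma nat_combinations_0 [simp]: "0 \<in> nat_combinations S"
  unfolding nat_combinations_def by (auto intro: exI[of _ "\<lambda>_. 0"])

lemma nat_combinations_add:
  "x \<in> nat_combinations S \<Longrightarrow> y \<in> nat_combinations S \<Longrightarrow> x + y \<in> nat_combinations S"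
proof -
  assume "x \<in> nat_combinations S" "y \<in> nat_combinations S"
  then obtain c d :: "'a \<Rightarrow> nat" where
    "x = (\<Sum>\<beta>\<in>S. real (c \<beta>) *\<^sub>R \<beta>)" "y = (\<Sum>\<beta>\<in>S. real (d \<beta>) *\<^sub>R \<beta>)"
    unfolding nat_combinations_def by auto
  then show ?thesis unfolding nat_combinations_def mem_Collect_eq
    by (intro exI[of _ "\<lambda>\<beta>. c \<beta> + d \<beta>"]) (simp add: scaleR_add_left sum.distrib)
qed

lemma nat_combinations_member:
  assumes "finite S" "x \<in> S" shows "x \<in> nat_combinations S"
proof -
  have "x = (\<Sum>\<beta>\<in>S. (if \<beta> = x then \<beta> else 0))"
    using assms by simp
  also have "\<dots> = (\<Sum>\<beta>\<in>S. real (if \<beta> = x then 1 else 0) *\<^sub>R \<beta>)"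
    by (intro sum.cong) auto
  finally show ?thesis unfolding nat_combinations_def
    by (auto intro!: exI[of _ "\<lambda>\<beta>. if \<beta> = x then 1 else 0"])
qed

lemma nat_combinations_nat_scaleR:
  "x \<in> nat_combinations S \<Longrightarrow> real n *\<^sub>R x \<in> nat_combinations S"
  by (induction n) (auto simp: scaleR_add_left nat_combinations_add)

lemma nat_combinations_sum:
  "(\<And>i. i \<in> I \<Longrightarrow> f i \<in> nat_combinations S) \<Longrightarrow> sum f I \<in> nat_combinations S"
  by (induction I rule: infinite_finite_induct) (auto simp: nat_combinations_add)

lemma nat_combinations_linear_image:
  assumes "linear u" "\<And>s. s \<in> S \<Longrightarrow> u s \<in> nat_combinations T" "x \<in> nat_combinations S"
  shows "u x \<in> nat_combinations T"
proof -
  obtain c :: "'a \<Rightarrow> nat" where "x = (\<Sum>\<beta>\<in>S. real (c \<beta>) *\<^sub>R \<beta>)"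
    using assms(3) unfolding nat_combinations_def by auto
  then have "u x = (\<Sum>\<beta>\<in>S. real (c \<beta>) *\<^sub>R u \<beta>)"
    using assms(1) by (simp add: linear_sum linear_scale)
  then show ?thesis
    using assms(2) by (auto intro!: nat_combinations_sum nat_combinations_nat_scaleR)
qed

lemma nat_combinations_inner_nonneg:
  assumes "\<And>\<beta>. \<beta> \<in> S \<Longrightarrow> 0 \<le> h \<bullet> \<beta>" "x \<in> nat_combinations S"
  shows "0 \<le> h \<bullet> x"
  using assms unfolding nat_combinations_def by (auto simp: inner_sum_right intro!: sum_nonneg)

lemma nat_combinations_inner_int:
  assumes "\<And>\<beta>. \<beta> \<in> S \<Longrightarrow> h \<bullet> \<beta> \<in> \<int>" "x \<in> nat_combinations S"
  shows "h \<bullet> x \<in> \<int>"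
  using assms unfolding nat_combinations_def by (auto simp: inner_sum_right intro!: Ints_sum)

text \<open>Applied to \<open>ht_vec\<close>, it makes adding a nonzero cone element raise the
  height by at least 1; the strictness and termination arguments rest on this.\<close>

lemma nat_combinations_inner_ge_1:
  assumes "finite S" "\<And>\<beta>. \<beta> \<in> S \<Longrightarrow> 1 \<le> h \<bullet> \<beta>" "x \<in> nat_combinations S" "x \<noteq> 0"
  shows "1 \<le> h \<bullet> x"
proof -
  obtain c :: "'a \<Rightarrow> nat" where c: "x = (\<Sum>\<beta>\<in>S. real (c \<beta>) *\<^sub>R \<beta>)"
    using assms(3) unfolding nat_combinations_def by auto
  then obtain \<beta> where b: "\<beta> \<in> S" "c \<beta> \<noteq> 0"
    using \<open>x \<noteq> 0\<close> by (metis (mono_tags, lifting) of_nat_0 scaleR_zero_left sum.neutral)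
  have "1 * 1 \<le> real (c \<beta>) * (h \<bullet> \<beta>)"
    using b assms(2) by (intro mult_mono) auto
  also have "\<dots> \<le> (\<Sum>\<beta>\<in>S. real (c \<beta>) * (h \<bullet> \<beta>))"
    using b assms(1,2) by (intro member_le_sum) (auto intro!: mult_nonneg_nonneg dest: assms(2) order_trans[OF zero_le_one])
  also have "\<dots> = h \<bullet> x" by (simp add: c inner_sum_right)
  finally show ?thesis by simp
qed

section \<open>Root systems and Weyl groups\<close>

locale based_root_system =
  fixes \<Phi> \<Delta> :: "'a::euclidean_space set"
  assumes root_system: "root_system \<Phi>" and simple_roots: "simple_roots \<Phi> \<Delta>"
begin

abbreviation pos :: "'a set" where "pos \<equiv> positive_roots \<Phi> \<Delta>"

lemma finite_roots [simp]: "finite \<Phi>"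
  and zero_notin_roots [simp]: "0 \<notin> \<Phi>"
  and span_roots: "span \<Phi> = UNIV"
  and cartan_int: "\<alpha> \<in> \<Phi> \<Longrightarrow> \<beta> \<in> \<Phi> \<Longrightarrow> cartan \<beta> \<alpha> \<in> \<int>"
  and root_multiple: "\<alpha> \<in> \<Phi> \<Longrightarrow> c *\<^sub>R \<alpha> \<in> \<Phi> \<Longrightarrow> c = 1 \<or> c = -1"
  using root_system by (auto simp: root_system_def cartan_def)

lemma root_nonzero: "\<alpha> \<in> \<Phi> \<Longrightarrow> \<alpha> \<noteq> 0"
  using zero_notin_roots by blast

lemma reflection_root: "\<alpha> \<in> \<Phi> \<Longrightarrow> \<beta> \<in> \<Phi> \<Longrightarrow> reflection \<alpha> \<beta> \<in> \<Phi>"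
  using root_system by (auto simp: root_system_def)

lemma uminus_root_iff [simp]: "- \<alpha> \<in> \<Phi> \<longleftrightarrow> \<alpha> \<in> \<Phi>"
proof -
  have "- \<alpha> \<in> \<Phi>" if "\<alpha> \<in> \<Phi>" for \<alpha>
    using reflection_root[OF that that] reflection_self[OF root_nonzero[OF that]] by simp
  from this[of \<alpha>] this[of "- \<alpha>"] show ?thesis by auto
qed

lemma simple_subset: "\<Delta> \<subseteq> \<Phi>"
  and independent_simple: "independent \<Delta>"
  using simple_roots by (auto simp: simple_roots_def)

lemma finite_simple [simp]: "finite \<Delta>"
  using finite_subset[OF simple_subset] by simp

lemma simple_root: "\<alpha> \<in> \<Delta> \<Longrightarrow> \<alpha> \<in> \<Phi>"
  using simple_subset by blast

lemma pos_root: "\<beta> \<in> pos \<Longrightarrow> \<beta> \<in> \<Phi>"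
  by (simp add: positive_roots_def)

lemma pos_or_neg: "\<beta> \<in> \<Phi> \<Longrightarrow> \<beta> \<in> pos \<or> - \<beta> \<in> pos"
  using simple_roots by (auto simp: positive_roots_def simple_roots_def)

lemma simple_pos: "\<alpha> \<in> \<Delta> \<Longrightarrow> \<alpha> \<in> pos"
  unfolding positive_roots_def by (simp add: simple_root nat_combinations_member)

lemma finite_pos [simp]: "finite pos"
  by (simp add: positive_roots_def)

lemma span_simple: "span \<Delta> = UNIV"
proof -
  have "nat_combinations \<Delta> \<subseteq> span \<Delta>"
    by (auto simp: nat_combinations_def intro!: span_sum intro: span_scale span_base)
  then have "\<Phi> \<subseteq> span \<Delta>"
    using pos_or_neg by (auto simp: positive_roots_def) (metis IntE span_neg subsetD minus_minus)
  then have "span \<Phi> \<subseteq> span \<Delta>"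
    by (metis span_mono span_span)
  then show ?thesis by (auto simp: span_roots)
qed

section \<open>Heights, coweights and coefficients at simple roots\<close>

lemma dual_vector: "\<exists>h. \<forall>\<alpha>\<in>\<Delta>. h \<bullet> \<alpha> = f \<alpha>"
proof -
  obtain g where g: "linear g" "\<And>\<alpha>. \<alpha> \<in> \<Delta> \<Longrightarrow> g \<alpha> = f \<alpha>"
    using linear_independent_extend[OF independent_simple, of f] by auto
  have "g x = (\<Sum>b\<in>Basis. g b *\<^sub>R b) \<bullet> x" for x
  proof -
    have "g x = g (\<Sum>b\<in>Basis. (x \<bullet> b) *\<^sub>R b)" by (simp add: euclidean_representation)
    also have "\<dots> = (\<Sum>b\<in>Basis. g b *\<^sub>R b) \<bullet> x"
      using g(1) by (simp add: linear_sum linear_scale inner_sum_left inner_commute[of x] mult.commute)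
    finally show ?thesis .
  qed
  with g(2) show ?thesis by metis
qed

text \<open>Pairing with this vector is the height, the sum of the coefficients at simple
  roots.\<close>

definition ht_vec :: 'a where "ht_vec = (SOME h. \<forall>\<alpha>\<in>\<Delta>. h \<bullet> \<alpha> = 1)"

text \<open>For simple \<open>\<alpha>\<close> this is the fundamental coweight, so coefficients at
  \<open>\<alpha>\<close> become inner products.\<close>

definition weight :: "'a \<Rightarrow> 'a" where
  "weight \<alpha> = (SOME h. \<forall>\<beta>\<in>\<Delta>. h \<bullet> \<beta> = (if \<beta> = \<alpha> then 1 else 0))"

lemma ht_vec_simple: "\<alpha> \<in> \<Delta> \<Longrightarrow> ht_vec \<bullet> \<alpha> = 1"
  using someI_ex[OF dual_vector[of "\<lambda>_. 1"]] by (simp add: ht_vec_def)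

lemma weight_simple: "\<beta> \<in> \<Delta> \<Longrightarrow> weight \<alpha> \<bullet> \<beta> = (if \<beta> = \<alpha> then 1 else 0)"
  using someI_ex[OF dual_vector[of "\<lambda>\<beta>. if \<beta> = \<alpha> then 1 else 0"]] by (simp add: weight_def)

lemma simple_expansion: "x = (\<Sum>\<alpha>\<in>\<Delta>. (weight \<alpha> \<bullet> x) *\<^sub>R \<alpha>)"
  and representation_weight: "\<alpha> \<in> \<Delta> \<Longrightarrow> representation \<Delta> x \<alpha> = weight \<alpha> \<bullet> x"
proof -
  have e: "(\<Sum>\<beta>\<in>\<Delta>. representation \<Delta> x \<beta> *\<^sub>R \<beta>) = x"
    using sum_representation_eq[OF independent_simple, of x \<Delta>] by (simp add: span_simple)
  have r: "representation \<Delta> x \<alpha> = weight \<alpha> \<bullet> x" if "\<alpha> \<in> \<Delta>" for \<alpha>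
  proof -
    have "weight \<alpha> \<bullet> x = (\<Sum>\<beta>\<in>\<Delta>. representation \<Delta> x \<beta> * (weight \<alpha> \<bullet> \<beta>))"
      by (subst e[symmetric]) (simp add: inner_sum_right)
    also have "\<dots> = (\<Sum>\<beta>\<in>\<Delta>. if \<beta> = \<alpha> then representation \<Delta> x \<beta> else 0)"
      by (intro sum.cong) (auto simp: weight_simple)
    finally show ?thesis using that by simp
  qed
  show "\<alpha> \<in> \<Delta> \<Longrightarrow> representation \<Delta> x \<alpha> = weight \<alpha> \<bullet> x" by (rule r)
  show "x = (\<Sum>\<alpha>\<in>\<Delta>. (weight \<alpha> \<bullet> x) *\<^sub>R \<alpha>)"
    using e by (simp add: r cong: sum.cong)
qed

lemma weight_pos: "\<alpha> \<in> \<Delta> \<Longrightarrow> \<beta> \<in> pos \<Longrightarrow> 0 \<le> weight \<alpha> \<bullet> \<beta>"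
  by (rule nat_combinations_inner_nonneg[of \<Delta>]) (auto simp: weight_simple positive_roots_def)

lemma weight_int: 
  assumes "\<alpha> \<in> \<Delta>" "\<beta> \<in> \<Phi>" shows "weight \<alpha> \<bullet> \<beta> \<in> \<int>"
proof -
  have *: "weight \<alpha> \<bullet> \<gamma> \<in> \<int>" if "\<gamma> \<in> pos" for \<gamma>
    by (rule nat_combinations_inner_int[of \<Delta>]) (use that in \<open>auto simp: weight_simple positive_roots_def\<close>)
  show ?thesis using pos_or_neg[OF assms(2)] *[of \<beta>] *[of "- \<beta>"] by auto
qed

lemma ht_pos: "\<beta> \<in> pos \<Longrightarrow> 1 \<le> ht_vec \<bullet> \<beta>"
  by (rule nat_combinations_inner_ge_1[of \<Delta>])
     (auto simp: ht_vec_simple positive_roots_def)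

lemma uminus_notin_pos: "\<beta> \<in> pos \<Longrightarrow> - \<beta> \<notin> pos"
  using ht_pos[of \<beta>] ht_pos[of "- \<beta>"] by auto

text \<open>Reflecting in \<open>\<alpha>\<close> changes only the coefficient at
  \<open>\<alpha>\<close>. If the image were negative, all other coefficients of
  \<open>\<beta>\<close> would vanish, making \<open>\<beta>\<close> a positive multiple of
  \<open>\<alpha>\<close> and hence equal to it.\<close>

lemma reflection_simple_pos:
  assumes "\<alpha> \<in> \<Delta>" "\<beta> \<in> pos" "\<beta> \<noteq> \<alpha>"
  shows "reflection \<alpha> \<beta> \<in> pos"
proof (rule ccontr)
  assume "reflection \<alpha> \<beta> \<notin> pos"
  then have neg: "- reflection \<alpha> \<beta> \<in> pos"
    using pos_or_neg reflection_root assms pos_root simple_root by blast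
  have "weight \<gamma> \<bullet> \<beta> = 0" if "\<gamma> \<in> \<Delta>" "\<gamma> \<noteq> \<alpha>" for \<gamma>
  proof -
    have "weight \<gamma> \<bullet> reflection \<alpha> \<beta> = weight \<gamma> \<bullet> \<beta>"
      using that assms by (simp add: reflection_cartan inner_diff_right weight_simple)
    then show ?thesis
      using weight_pos[OF that(1) neg] weight_pos[OF that(1) assms(2)] by simp
  qed
  then have "\<beta> = (\<Sum>\<gamma>\<in>\<Delta>. if \<gamma> = \<alpha> then (weight \<alpha> \<bullet> \<beta>) *\<^sub>R \<alpha> else 0)"
    by (subst simple_expansion) (intro sum.cong, auto)
  then have b: "\<beta> = (weight \<alpha> \<bullet> \<beta>) *\<^sub>R \<alpha>" using assms(1) by simp
  then have "weight \<alpha> \<bullet> \<beta> = 1 \<or> weight \<alpha> \<bullet> \<beta> = -1"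
    using root_multiple[of \<alpha> "weight \<alpha> \<bullet> \<beta>"] assms(1,2) pos_root simple_root by metis
  then show False using b assms weight_pos[OF assms(1,2)] by auto
qed

section \<open>Simple words and the exchange condition\<close>

lemma word_product_root: "set \<alpha>s \<subseteq> \<Phi> \<Longrightarrow> \<beta> \<in> \<Phi> \<Longrightarrow> word_product \<alpha>s \<beta> \<in> \<Phi>"
  by (induction \<alpha>s) (auto simp: reflection_root)

text \<open>Induction on the height. As \<open>\<beta> \<bullet> \<beta>\<close> is positive, some
  simple \<open>\<alpha>\<close> has positive inner product with \<open>\<beta>\<close>; reflecting
  \<open>\<beta>\<close> in it lowers the height, and conjugation by that reflection carries a word
  back.\<close>

lemma reflection_simple_word:
  assumes "\<beta> \<in> pos"
  shows "\<exists>\<alpha>s. set \<alpha>s \<subseteq> \<Delta> \<and> word_product \<alpha>s = reflection \<beta>"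
  using assms
proof (induction "nat \<lfloor>ht_vec \<bullet> \<beta>\<rfloor>" arbitrary: \<beta> rule: less_induct)
  case less
  show ?case
  proof (cases "\<beta> \<in> \<Delta>")
    case True
    then show ?thesis by (intro exI[of _ "[\<beta>]"]) auto
  next
    case False
    have "\<exists>\<alpha>\<in>\<Delta>. \<beta> \<bullet> \<alpha> > 0"
    proof (rule ccontr)
      assume "\<not> ?thesis"
      then have "(\<Sum>\<alpha>\<in>\<Delta>. (weight \<alpha> \<bullet> \<beta>) * (\<beta> \<bullet> \<alpha>)) \<le> 0"
        by (intro sum_nonpos) (auto simp: mult_nonneg_nonpos weight_pos less.prems not_less)
      moreover have "(\<Sum>\<alpha>\<in>\<Delta>. (weight \<alpha> \<bullet> \<beta>) * (\<beta> \<bullet> \<alpha>)) = \<beta> \<bullet> \<beta>"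
        by (simp flip: inner_sum_right inner_scaleR_right simple_expansion)
      ultimately show False
        using root_nonzero[OF pos_root[OF less.prems]] inner_gt_zero_iff[of \<beta>] by linarith
    qed
    then obtain \<alpha> where a: "\<alpha> \<in> \<Delta>" "\<beta> \<bullet> \<alpha> > 0" by blast
    let ?\<gamma> = "reflection \<alpha> \<beta>"
    have g: "?\<gamma> \<in> pos" using reflection_simple_pos a False less.prems by blast
    have "cartan \<beta> \<alpha> \<in> \<int>" "cartan \<beta> \<alpha> > 0"
      using a less.prems by (auto simp: cartan_int pos_root simple_root cartan_pos_iff root_nonzero)
    then have "cartan \<beta> \<alpha> \<ge> 1" by (auto elim!: Ints_cases)
    then have "ht_vec \<bullet> ?\<gamma> \<le> ht_vec \<bullet> \<beta> - 1"
      by (simp add: reflection_cartan inner_diff_right ht_vec_simple a)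
    with ht_pos[OF g] have "nat \<lfloor>ht_vec \<bullet> ?\<gamma>\<rfloor> < nat \<lfloor>ht_vec \<bullet> \<beta>\<rfloor>" by linarith
    from less.hyps[OF this g] obtain \<alpha>s where
      as: "set \<alpha>s \<subseteq> \<Delta>" "word_product \<alpha>s = reflection ?\<gamma>" by blast
    have "word_product (\<alpha> # \<alpha>s @ [\<alpha>]) = reflection \<beta>"
      using reflection_conj[OF orthogonal_transformation_reflection, of \<alpha> \<beta>]
      by (simp add: word_product_append as fun_eq_iff)
    then show ?thesis using as a by (intro exI[of _ "\<alpha> # \<alpha>s @ [\<alpha>]"]) auto
  qed
qed

lemma weyl_group_simple_word:
  assumes "w \<in> weyl_group \<Phi>"
  shows "\<exists>\<alpha>s. set \<alpha>s \<subseteq> \<Delta> \<and> word_product \<alpha>s = w"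
proof -
  have "\<exists>\<alpha>s. set \<alpha>s \<subseteq> \<Delta> \<and> word_product \<alpha>s = word_product \<beta>s" if "set \<beta>s \<subseteq> \<Phi>" for \<beta>s
    using that
  proof (induction \<beta>s)
    case Nil
    show ?case by (intro exI[of _ "[]"]) simp
  next
    case (Cons b \<beta>s)
    then obtain \<alpha>s where as: "set \<alpha>s \<subseteq> \<Delta>" "word_product \<alpha>s = word_product \<beta>s" by auto
    have "\<exists>xs. set xs \<subseteq> \<Delta> \<and> word_product xs = reflection b"
      using reflection_simple_word[of b] reflection_simple_word[of "- b"] pos_or_neg[of b] Cons.prems
      by auto
    then obtain xs where "set xs \<subseteq> \<Delta>" "word_product xs = reflection b" by blast
    with as show ?case by (intro exI[of _ "xs @ \<alpha>s"]) (simp add: word_product_append)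
  qed
  then show ?thesis using assms by (auto simp: weyl_group_def)
qed

text \<open>Let the letters act on \<open>\<alpha>\<close> from the right. The letter at which the
  image leaves the positive roots must equal the root it acts on, and multiplying by
  \<open>reflection \<alpha>\<close> cancels that letter.\<close>

lemma exchange:
  assumes "set \<alpha>s \<subseteq> \<Delta>" "\<alpha> \<in> \<Delta>" "word_product \<alpha>s \<alpha> \<notin> pos"
  shows "\<exists>\<beta>s. set \<beta>s \<subseteq> \<Delta> \<and> length \<beta>s < length \<alpha>s \<and>
           word_product \<beta>s = word_product \<alpha>s \<circ> reflection \<alpha>"
  using assms
proof (induction \<alpha>s)
  case Nil
  then show ?case using simple_pos by auto
next
  case (Cons a \<alpha>s)
  let ?u = "word_product \<alpha>s"
  show ?case
  proof (cases "?u \<alpha> \<in> pos")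
    case False
    then obtain \<beta>s where "set \<beta>s \<subseteq> \<Delta>" "length \<beta>s < length \<alpha>s"
      "word_product \<beta>s = ?u \<circ> reflection \<alpha>"
      using Cons.IH Cons.prems by (auto simp del: o_apply)
    then show ?thesis using Cons.prems by (intro exI[of _ "a # \<beta>s"]) (auto simp: comp_assoc)
  next
    case True
    then have "?u \<alpha> = a"
      using reflection_simple_pos[of a "?u \<alpha>"] Cons.prems by auto
    then have "word_product (a # \<alpha>s) \<circ> reflection \<alpha> = ?u"
      using reflection_conj[OF orthogonal_transformation_word_product[of \<alpha>s], of \<alpha>]
      by (auto simp: fun_eq_iff)
    then show ?thesis using Cons.prems by (intro exI[of _ \<alpha>s]) (simp del: o_apply)
  qed
qed

text \<open>Otherwise \<open>v = w \<circ> reflection \<alpha>\<close> sends \<open>\<alpha>\<close>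
  outside \<open>pos\<close>, and exchange on a shortest word of \<open>v\<close> yields a shorter
  word for \<open>w\<close>, so \<open>v\<close> would be longer than \<open>w\<close>.\<close>

lemma longest_element_simple:
  assumes "longest_element \<Phi> \<Delta> w" "\<alpha> \<in> \<Delta>"
  shows "- w \<alpha> \<in> pos"
proof (rule ccontr)
  assume "- w \<alpha> \<notin> pos"
  have w: "w \<in> weyl_group \<Phi>" using assms by (simp add: longest_element_def)
  then obtain \<beta>s where bs: "set \<beta>s \<subseteq> \<Phi>" "w = word_product \<beta>s" by (auto simp: weyl_group_def)
  define v where "v = w \<circ> reflection \<alpha>"
  have "v = word_product (\<beta>s @ [\<alpha>])" by (simp add: v_def bs word_product_append)
  then have v: "v \<in> weyl_group \<Phi>"
    using bs simple_root assms(2) by (fastforce simp: weyl_group_def)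
  let ?P = "\<lambda>n. \<exists>\<alpha>s. set \<alpha>s \<subseteq> \<Delta> \<and> length \<alpha>s = n \<and> word_product \<alpha>s = v"
  have "\<exists>n. ?P n" using weyl_group_simple_word[OF v] by blast
  then have "?P (weyl_length \<Delta> v)" unfolding weyl_length_def by (rule LeastI_ex)
  then obtain \<alpha>s where as: "set \<alpha>s \<subseteq> \<Delta>" "length \<alpha>s = weyl_length \<Delta> v" "word_product \<alpha>s = v" 
    by blast
  have lin: "linear w"
    using bs orthogonal_transformation_word_product orthogonal_transformation_linear by blast
  have "v \<alpha> = - w \<alpha>"
    using assms(2) lin by (simp add: v_def reflection_self root_nonzero simple_root linear_neg)
  then have "word_product \<alpha>s \<alpha> \<notin> pos" using as \<open>- w \<alpha> \<notin> pos\<close> by simp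
  from exchange[OF as(1) assms(2) this] obtain \<gamma>s where
    gs: "set \<gamma>s \<subseteq> \<Delta>" "length \<gamma>s < length \<alpha>s" "word_product \<gamma>s = v \<circ> reflection \<alpha>"
    using as by auto
  then have "word_product \<gamma>s = w" by (auto simp: v_def fun_eq_iff)
  then have "weyl_length \<Delta> w \<le> length \<gamma>s"
    unfolding weyl_length_def using gs by (intro Least_le) blast
  also have "\<dots> < weyl_length \<Delta> v" using gs as by simp
  also have "\<dots> \<le> weyl_length \<Delta> w" using assms(1) v by (simp add: longest_element_def)
  finally show False by simp
qed

section \<open>Dominant vectors in Weyl group orbits\<close>

definition dominant :: "'a \<Rightarrow> bool" where
  "dominant x \<longleftrightarrow> (\<forall>\<beta>\<in>pos. 0 \<le> x \<bullet> \<beta>)"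

text \<open>Strip the last letter \<open>\<alpha>\<close>. If the remaining word \<open>?u\<close>
  keeps \<open>\<alpha>\<close> positive, that letter only subtracts a nonnegative multiple of
  \<open>?u \<alpha>\<close>, which pairs nonnegatively with \<open>y\<close>; otherwise the word
  can be shortened.\<close>

lemma dominant_inner_le:
  assumes "set \<alpha>s \<subseteq> \<Delta>" "dominant x" "dominant y"
  shows "word_product \<alpha>s x \<bullet> y \<le> x \<bullet> y"
  using assms(1)
proof (induction "length \<alpha>s" arbitrary: \<alpha>s rule: less_induct)
  case less
  show ?case
  proof (cases \<alpha>s rule: rev_cases)
    case Nil
    then show ?thesis by simp
  next
    case (snoc \<beta>s \<alpha>)
    let ?u = "word_product \<beta>s"
    have lin: "linear ?u"
      using orthogonal_transformation_word_product orthogonal_transformation_linear by blast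
    have a: "\<alpha> \<in> \<Delta>" using less.prems snoc by simp
    show ?thesis
    proof (cases "?u \<alpha> \<in> pos")
      case True
      have "0 \<le> cartan x \<alpha>"
        using assms(2) a simple_pos by (auto simp: dominant_def cartan_def)
      moreover have "0 \<le> ?u \<alpha> \<bullet> y"
        using assms(3) True by (auto simp: dominant_def inner_commute)
      moreover have "word_product \<alpha>s x = ?u x - cartan x \<alpha> *\<^sub>R ?u \<alpha>"
        using lin by (simp add: snoc word_product_append reflection_cartan linear_diff linear_scale)
      ultimately have "word_product \<alpha>s x \<bullet> y \<le> ?u x \<bullet> y"
        by (simp add: inner_diff_left)
      also have "\<dots> \<le> x \<bullet> y" using less snoc by auto
      finally show ?thesis .
    next
      case False
      then obtain \<gamma>s where "set \<gamma>s \<subseteq> \<Delta>" "length \<gamma>s < length \<beta>s"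
        "word_product \<gamma>s = ?u \<circ> reflection \<alpha>"
        using exchange[of \<beta>s \<alpha>] less.prems snoc by auto
      then show ?thesis using less.hyps[of \<gamma>s] snoc by (auto simp: word_product_append)
    qed
  qed
qed

text \<open>Pairing with the dominant image itself and using that both vectors have equal length
  gives a nonpositive squared distance.\<close>

lemma dominant_orbit_unique:
  assumes "set \<alpha>s \<subseteq> \<Phi>" "dominant x" "dominant (word_product \<alpha>s x)"
  shows "word_product \<alpha>s x = x"
proof -
  let ?y = "word_product \<alpha>s x"
  obtain \<beta>s where "set \<beta>s \<subseteq> \<Delta>" "word_product \<beta>s = word_product \<alpha>s"
    using weyl_group_simple_word[of "word_product \<alpha>s"] assms(1) by (auto simp: weyl_group_def)
  then have "?y \<bullet> ?y \<le> x \<bullet> ?y" using dominant_inner_le assms by metis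
  moreover have "?y \<bullet> ?y = x \<bullet> x"
    using orthogonal_transformation_word_product[of \<alpha>s] by (simp add: orthogonal_transformation_def)
  ultimately have "(?y - x) \<bullet> (?y - x) \<le> 0"
    by (simp add: inner_diff_left inner_diff_right inner_commute)
  then show ?thesis
    using inner_gt_zero_iff[of "?y - x"] by (metis leD eq_iff_diff_eq_0)
qed

end

section \<open>Hermitian pairs\<close>

locale hermitian = based_root_system +
  fixes \<alpha>q :: 'a
  assumes hermitian: "hermitian_pair \<Phi> \<Delta> \<alpha>q"
begin

abbreviation \<omega> :: 'a where "\<omega> \<equiv> weight \<alpha>q"
abbreviation Phi1 :: "'a set" where "Phi1 \<equiv> Phi1_pos \<Phi> \<Delta> \<alpha>q"
abbreviation Phi0 :: "'a set" where "Phi0 \<equiv> Phi0_pos \<Phi> \<Delta> \<alpha>q"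
abbreviation cone :: "'a set" where "cone \<equiv> nat_combinations Phi0"

text \<open>The full root system of the Levi subalgebra, both signs; \<open>Phi0\<close> is its
  positive half.\<close>

definition levi :: "'a set" where "levi = {\<beta> \<in> \<Phi>. \<omega> \<bullet> \<beta> = 0}"

lemma q_simple: "\<alpha>q \<in> \<Delta>"
  using hermitian by (simp add: hermitian_pair_def)

text \<open>The highest root bounds the coefficient of every root by 1. Applying this to
  \<open>\<beta>\<close> and \<open>- \<beta>\<close>, together with integrality, leaves three
  values.\<close>

lemma coefficient_cases:
  assumes "\<beta> \<in> \<Phi>"
  shows "\<omega> \<bullet> \<beta> = -1 \<or> \<omega> \<bullet> \<beta> = 0 \<or> \<omega> \<bullet> \<beta> = 1"
proof -
  obtain \<theta> where \<theta>: "highest_root \<Phi> \<Delta> \<theta>" "\<omega> \<bullet> \<theta> = 1"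
    using hermitian representation_weight[OF q_simple] unfolding hermitian_pair_def by metis
  have le: "\<omega> \<bullet> \<gamma> \<le> 1" if "\<gamma> \<in> \<Phi>" for \<gamma>
  proof -
    have "0 \<le> \<omega> \<bullet> (\<theta> - \<gamma>)"
      by (rule nat_combinations_inner_nonneg[of \<Delta>])
         (use \<theta>(1) that in \<open>auto simp: weight_simple highest_root_def\<close>)
    then show ?thesis using \<theta>(2) by (simp add: inner_diff_right)
  qed
  obtain z where z: "\<omega> \<bullet> \<beta> = of_int z"
    using weight_int[OF q_simple assms] by (auto elim: Ints_cases)
  then have "-1 \<le> z" "z \<le> 1"
    using le[of \<beta>] le[of "- \<beta>"] assms by auto
  then have "z = -1 \<or> z = 0 \<or> z = 1" by linarith
  with z show ?thesis by auto
qed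

text \<open>Positivity is automatic, since a negative root has nonpositive coefficient at
  \<open>\<alpha>q\<close>. Membership thus becomes easy to check after a reflection.\<close>

lemma Phi1_iff: "\<beta> \<in> Phi1 \<longleftrightarrow> \<beta> \<in> \<Phi> \<and> \<omega> \<bullet> \<beta> = 1"
  using pos_or_neg[of \<beta>] weight_pos[OF q_simple, of "- \<beta>"]
  by (auto simp: Phi1_pos_def representation_weight q_simple pos_root)

lemma Phi0_iff: "\<beta> \<in> Phi0 \<longleftrightarrow> \<beta> \<in> pos \<and> \<omega> \<bullet> \<beta> = 0"
  by (auto simp: Phi0_pos_def representation_weight q_simple)

lemma finite_Phi1 [simp]: "finite Phi1"
  by (rule finite_subset[OF _ finite_roots]) (auto simp: Phi1_iff)

lemma finite_Phi0 [simp]: "finite Phi0"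
  by (rule finite_subset[OF _ finite_roots]) (auto simp: Phi0_iff pos_root)

lemma Phi1_nonzero: "\<beta> \<in> Phi1 \<Longrightarrow> \<beta> \<noteq> 0"
  by (auto simp: Phi1_iff)

lemma levi_cases: "\<gamma> \<in> levi \<Longrightarrow> \<gamma> \<in> Phi0 \<or> - \<gamma> \<in> Phi0"
  using pos_or_neg by (auto simp: levi_def Phi0_iff)

lemma Phi0_levi: "\<gamma> \<in> Phi0 \<Longrightarrow> \<gamma> \<in> levi"
  by (auto simp: levi_def Phi0_iff pos_root)

lemma uminus_notin_Phi0: "\<gamma> \<in> Phi0 \<Longrightarrow> - \<gamma> \<notin> Phi0"
  using uminus_notin_pos by (auto simp: Phi0_iff)

lemma Phi0_cone: "\<gamma> \<in> Phi0 \<Longrightarrow> \<gamma> \<in> cone"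
  by (simp add: nat_combinations_member)

lemma cone_ht: "v \<in> cone \<Longrightarrow> v \<noteq> 0 \<Longrightarrow> 1 \<le> ht_vec \<bullet> v"
  by (rule nat_combinations_inner_ge_1[of Phi0]) (auto simp: Phi0_iff ht_pos)

lemma cone_antisym: "v \<in> cone \<Longrightarrow> - v \<in> cone \<Longrightarrow> v = 0"
  using cone_ht[of v] cone_ht[of "- v"] by fastforce

lemma le0_refl [simp]: "le0 \<Phi> \<Delta> \<alpha>q \<mu> \<mu>"
  by (simp add: le0_def)

lemma le0_trans: "le0 \<Phi> \<Delta> \<alpha>q \<mu> \<nu> \<Longrightarrow> le0 \<Phi> \<Delta> \<alpha>q \<nu> \<xi> \<Longrightarrow> le0 \<Phi> \<Delta> \<alpha>q \<mu> \<xi>"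
  using nat_combinations_add[of "\<nu> - \<mu>" Phi0 "\<xi> - \<nu>"] by (simp add: le0_def)

lemma le0_antisym: "le0 \<Phi> \<Delta> \<alpha>q \<mu> \<nu> \<Longrightarrow> le0 \<Phi> \<Delta> \<alpha>q \<nu> \<mu> \<Longrightarrow> \<mu> = \<nu>"
  using cone_antisym[of "\<nu> - \<mu>"] by (simp add: le0_def)

text \<open>Both restrictions on Cartan integers hold because reflecting at \<open>\<alpha>\<close> must not leave the
  range \<open>{-1, 0, 1}\<close> of coefficients at \<open>\<alpha>q\<close>.\<close>

lemma cartan_levi:
  assumes "\<gamma> \<in> levi" "\<alpha> \<in> Phi1"
  shows "cartan \<gamma> \<alpha> = -1 \<or> cartan \<gamma> \<alpha> = 0 \<or> cartan \<gamma> \<alpha> = 1"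
proof -
  have "reflection \<alpha> \<gamma> \<in> \<Phi>" "\<omega> \<bullet> reflection \<alpha> \<gamma> = - cartan \<gamma> \<alpha>"
    using assms by (auto simp: levi_def Phi1_iff reflection_root) 
      (simp add: reflection_cartan inner_diff_right)
  then show ?thesis using coefficient_cases[of "reflection \<alpha> \<gamma>"] by auto
qed

lemma cartan_Phi1:
  assumes "\<beta> \<in> Phi1" "\<alpha> \<in> Phi1"
  shows "cartan \<beta> \<alpha> = 0 \<or> cartan \<beta> \<alpha> = 1 \<or> cartan \<beta> \<alpha> = 2"
proof -
  have "reflection \<alpha> \<beta> \<in> \<Phi>" "\<omega> \<bullet> reflection \<alpha> \<beta> = 1 - cartan \<beta> \<alpha>"
    using assms by (auto simp: Phi1_iff reflection_root)
      (simp add: reflection_cartan inner_diff_right)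
  then show ?thesis using coefficient_cases[of "reflection \<alpha> \<beta>"] by auto
qed

lemma reflection_levi_Phi1: "\<gamma> \<in> levi \<Longrightarrow> \<beta> \<in> Phi1 \<Longrightarrow> reflection \<gamma> \<beta> \<in> Phi1"
  by (auto simp: levi_def Phi1_iff reflection_root) (simp add: reflection_cartan inner_diff_right)

lemma reflection_levi_omega: "\<gamma> \<in> levi \<Longrightarrow> reflection \<gamma> \<omega> = \<omega>"
  by (simp add: levi_def reflection_fix orthogonal_def)

text \<open>If neither Cartan number were 1, both would be 2, forcing the roots to coincide. A
  Cartan number 1 makes a reflection produce the difference up to sign.\<close>

lemma diff_levi:
  assumes "\<alpha> \<in> Phi1" "\<beta> \<in> Phi1" "\<alpha> \<noteq> \<beta>" "\<alpha> \<bullet> \<beta> \<noteq> 0"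
  shows "\<alpha> - \<beta> \<in> levi"
proof -
  have nz: "\<alpha> \<noteq> 0" "\<beta> \<noteq> 0" using assms Phi1_nonzero by auto
  have *: "cartan \<alpha> \<beta> = 1 \<or> cartan \<beta> \<alpha> = 1"
  proof (rule ccontr)
    assume "\<not> ?thesis"
    then have "cartan \<alpha> \<beta> = 2" "cartan \<beta> \<alpha> = 2"
      using cartan_Phi1[OF assms(1,2)] cartan_Phi1[OF assms(2,1)] assms(4) nz
      by (auto simp: cartan_eq_0_iff orthogonal_def inner_commute)
    then have "\<alpha> \<bullet> \<beta> = \<beta> \<bullet> \<beta>" "\<alpha> \<bullet> \<beta> = \<alpha> \<bullet> \<alpha>"
      using nz by (auto simp: cartan_def field_simps inner_commute)
    then have "(\<alpha> - \<beta>) \<bullet> (\<alpha> - \<beta>) = 0"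
      by (simp add: inner_diff_left inner_diff_right inner_commute)
    then show False using assms(3) by simp
  qed
  have "\<alpha> - \<beta> \<in> \<Phi>"
    using * 
  proof
    assume "cartan \<alpha> \<beta> = 1"
    then show ?thesis
      using reflection_root[of \<beta> \<alpha>] assms by (simp add: reflection_cartan Phi1_iff)
  next
    assume "cartan \<beta> \<alpha> = 1"
    then show ?thesis
      using reflection_root[of \<alpha> \<beta>] assms uminus_root_iff[of "\<beta> - \<alpha>"] 
      by (simp add: reflection_cartan Phi1_iff)
  qed
  then show ?thesis using assms by (simp add: levi_def Phi1_iff inner_diff_right)
qed

section \<open>Orthogonal subsets of \<open>Phi1\<close> and their reflections\<close>

lemma Ort_Phi1:
  assumes "B \<in> Ort Phi1"
  shows "finite B" "B \<subseteq> Phi1" "pairwise orthogonal B" "0 \<notin> B"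
  using assms finite_subset[OF _ finite_Phi1] Phi1_nonzero by (auto simp: Ort_def)

lemma Ort_reflection:
  assumes "\<gamma> \<in> levi" "B \<in> Ort Phi1"
  shows "reflection \<gamma> ` B \<in> Ort Phi1"
proof -
  have "pairwise orthogonal (reflection \<gamma> ` B)"
    using Ort_Phi1(3)[OF assms(2)] orthogonal_transformation_reflection[of \<gamma>]
    by (auto simp: pairwise_def orthogonal_def orthogonal_transformation_def)
  then show ?thesis using assms reflection_levi_Phi1 by (auto simp: Ort_def)
qed

lemma Ort_max_reflection:
  assumes "\<gamma> \<in> levi" "B \<in> Ort_max Phi1"
  shows "reflection \<gamma> ` B \<in> Ort_max Phi1"
proof -
  have img: "reflection \<gamma> ` reflection \<gamma> ` C = C" for C by (simp add: image_image)
  have "reflection \<gamma> ` B = C" if C: "C \<in> Ort Phi1" "reflection \<gamma> ` B \<subseteq> C" for C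
  proof -
    have "B \<subseteq> reflection \<gamma> ` C" using C(2) img by (metis image_mono)
    then have "B = reflection \<gamma> ` C"
      using assms Ort_reflection[OF assms(1) C(1)] by (auto simp: Ort_max_def)
    then show ?thesis using img by metis
  qed
  then show ?thesis using assms Ort_reflection by (auto simp: Ort_max_def)
qed

lemma set_reflection_root:
  assumes "B \<in> Ort Phi1" "\<beta> \<in> \<Phi>"
  shows "set_reflection B \<beta> \<in> \<Phi>"
proof -
  obtain \<alpha>s where "set \<alpha>s = B" "word_product \<alpha>s = set_reflection B"
    using set_reflection_word_product Ort_Phi1[OF assms(1)] by blast
  then show ?thesis
    using word_product_root[of \<alpha>s \<beta>] assms Ort_Phi1(2) by (metis Phi1_iff subset_iff)
qed

text \<open>Because \<open>\<omega>\<close> pairs to 1 with each member of \<open>B\<close>, the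
  vector \<open>\<omega> - set_reflection B \<omega>\<close> is the sum of the coroots of
  \<open>B\<close>.\<close>

lemma set_reflection_omega_inner:
  assumes "B \<subseteq> Phi1"
  shows "set_reflection B \<omega> \<bullet> v = \<omega> \<bullet> v - (\<Sum>\<beta>\<in>B. cartan v \<beta>)"
proof -
  have "(\<Sum>\<beta>\<in>B. cartan \<omega> \<beta> * (\<beta> \<bullet> v)) = (\<Sum>\<beta>\<in>B. cartan v \<beta>)"
    using assms by (intro sum.cong) (auto simp: cartan_def Phi1_iff inner_commute)
  then show ?thesis
    by (simp add: set_reflection_def inner_diff_left inner_sum_left)
qed

text \<open>The condition says that the coroots of \<open>B\<close> sum to
  \<open>2 *\<^sub>R \<omega>\<close>. It implies maximality, and in tube type is equivalent to
  it.\<close>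

definition full :: "'a set \<Rightarrow> bool" where
  "full B \<longleftrightarrow> B \<in> Ort Phi1 \<and> set_reflection B \<omega> = - \<omega>"

lemma full_sum_cartan:
  assumes "full B" shows "(\<Sum>\<beta>\<in>B. cartan v \<beta>) = 2 * (\<omega> \<bullet> v)"
  using assms set_reflection_omega_inner[of B v] by (auto simp: full_def Ort_def)

lemma full_reflection: "\<gamma> \<in> levi \<Longrightarrow> full B \<Longrightarrow> full (reflection \<gamma> ` B)"
  using set_reflection_image[OF orthogonal_transformation_reflection, of \<gamma> B \<omega>]
    orthogonal_transformation_linear[OF orthogonal_transformation_reflection, of \<gamma>]
  by (simp add: full_def Ort_reflection reflection_levi_omega linear_neg)

text \<open>A root of \<open>Phi1\<close> orthogonal to \<open>B\<close> would have Cartan sum 0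
  against \<open>B\<close>, whereas fullness makes that sum 2.\<close>

lemma full_Ort_max:
  assumes "full B" shows "B \<in> Ort_max Phi1"
proof -
  have "C \<subseteq> B" if C: "C \<in> Ort Phi1" "B \<subseteq> C" for C
  proof
    fix \<gamma> assume g: "\<gamma> \<in> C"
    show "\<gamma> \<in> B"
    proof (rule ccontr)
      assume "\<gamma> \<notin> B"
      then have "(\<Sum>\<beta>\<in>B. cartan \<gamma> \<beta>) = 0"
        using C g Ort_Phi1(3)[OF C(1)]
        by (intro sum.neutral ballI cartan_orthogonal) (metis pairwiseD subsetD)
      then show False
        using full_sum_cartan[OF assms, of \<gamma>] g Ort_Phi1(2)[OF C(1)] by (auto simp: Phi1_iff)
    qed
  qed
  then show ?thesis using assms by (auto simp: Ort_max_def full_def)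
qed

end

section \<open>Tube type: maximal orthogonal sets are full\<close>

locale hermitian_tube = hermitian +
  assumes tube: "tube_type \<Phi> \<Delta> \<alpha>q"
begin

text \<open>The longest element negates \<open>\<alpha>q\<close> and must be shown to negate the
  coweight too. For another simple root \<open>\<alpha> = - w \<beta>\<close> this means that
  \<open>\<beta>\<close> has coefficient 0 at \<open>\<alpha>q\<close>; the argument avoids proving
  first that \<open>- w\<close> permutes the simple roots.\<close>

lemma omega_orbit: "\<exists>\<alpha>s. set \<alpha>s \<subseteq> \<Phi> \<and> word_product \<alpha>s \<omega> = - \<omega>"
proof -
  obtain w where w: "longest_element \<Phi> \<Delta> w" "w \<alpha>q = - \<alpha>q"
    using tube by (auto simp: tube_type_def)
  then obtain \<alpha>s where as: "set \<alpha>s \<subseteq> \<Phi>" "w = word_product \<alpha>s"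
    by (auto simp: longest_element_def weyl_group_def)
  have ot: "orthogonal_transformation w" using as orthogonal_transformation_word_product by simp
  then have lin: "linear w" and "inj w"
    using orthogonal_transformation_linear orthogonal_transformation_inj by blast+
  have "w ` \<Phi> = \<Phi>"
    using as word_product_root \<open>inj w\<close>
    by (intro card_subset_eq) (auto simp: card_image inj_on_subset)
  have neg: "- w \<beta> \<in> pos" if "\<beta> \<in> pos" for \<beta>
  proof -
    have "- w \<beta> \<in> nat_combinations \<Delta>"
      using nat_combinations_linear_image[of "\<lambda>x. - w x" \<Delta> \<Delta> \<beta>] that w lin
        longest_element_simple by (auto simp: positive_roots_def linear_compose_neg)
    then show ?thesis using as that word_product_root by (auto simp: positive_roots_def)
  qed
  have "w \<omega> \<bullet> \<alpha> = - (\<omega> \<bullet> \<alpha>)" if a: "\<alpha> \<in> \<Delta>" for \<alpha>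
  proof -
    obtain \<beta> where b: "\<beta> \<in> \<Phi>" "w \<beta> = - \<alpha>"
      using \<open>w ` \<Phi> = \<Phi>\<close> a simple_root by (metis (no_types) imageE uminus_root_iff)
    have inn: "w \<omega> \<bullet> \<alpha> = - (\<omega> \<bullet> \<beta>)"
      using b ot by (metis orthogonal_transformation_def inner_minus_right minus_minus)
    show ?thesis
    proof (cases "\<alpha> = \<alpha>q")
      case True
      then have "\<beta> = \<alpha>q" using b w \<open>inj w\<close> by (metis injD)
      then show ?thesis using inn True by simp
    next
      case False
      have bp: "\<beta> \<in> pos"
        using pos_or_neg[OF b(1)] neg[of "- \<beta>"] b a lin simple_pos[of \<alpha>] uminus_notin_pos[of \<alpha>]
        by (auto simp: linear_neg)
      have "\<alpha> = (\<Sum>\<gamma>\<in>\<Delta>. (weight \<gamma> \<bullet> \<beta>) *\<^sub>R (- w \<gamma>))"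
      proof -
        have "\<alpha> = - w (\<Sum>\<gamma>\<in>\<Delta>. (weight \<gamma> \<bullet> \<beta>) *\<^sub>R \<gamma>)"
          using b by (simp flip: simple_expansion)
        then show ?thesis using lin by (simp add: linear_sum linear_scale sum_negf)
      qed
      then have "\<omega> \<bullet> \<alpha> = (\<Sum>\<gamma>\<in>\<Delta>. (weight \<gamma> \<bullet> \<beta>) * (\<omega> \<bullet> (- w \<gamma>)))"
        by (metis (no_types, lifting) inner_scaleR_right inner_sum_right sum.cong)
      then have "0 = (\<Sum>\<gamma>\<in>\<Delta>. (weight \<gamma> \<bullet> \<beta>) * (\<omega> \<bullet> (- w \<gamma>)))"
        using False a by (simp add: weight_simple)
      \<comment> \<open>All summands are nonnegative. Since
        \<open>- w \<alpha>q = \<alpha>q\<close>, the summand at \<open>\<alpha>q\<close> is the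
        coefficient of \<open>\<beta>\<close> there, which therefore vanishes.\<close>
      also have "\<dots> \<ge> (weight \<alpha>q \<bullet> \<beta>) * (\<omega> \<bullet> (- w \<alpha>q))"
        using q_simple weight_pos[OF _ bp] weight_pos[OF q_simple neg[OF simple_pos]]
        by (intro member_le_sum) (auto intro!: mult_nonneg_nonneg simp del: inner_minus_right)
      finally have "\<omega> \<bullet> \<beta> \<le> 0" using w q_simple by (simp add: weight_simple)
      then have "\<omega> \<bullet> \<beta> = 0" using weight_pos[OF q_simple bp] by simp
      then show ?thesis using inn a False by (simp add: weight_simple)
    qed
  qed
  then have "(w \<omega> + \<omega>) \<bullet> \<alpha> = 0" if "\<alpha> \<in> \<Delta>" for \<alpha>
    using that by (simp add: inner_add_left)
  then have "(w \<omega> + \<omega>) \<bullet> x = 0" for x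
    by (subst simple_expansion[of x]) (simp add: inner_sum_right)
  then have "w \<omega> + \<omega> = 0" by (metis inner_eq_zero_iff)
  then show ?thesis using as by (auto intro!: exI[of _ \<alpha>s] simp: add_eq_0_iff2)
qed

text \<open>By maximality \<open>\<gamma>\<close> is not orthogonal to all of \<open>B\<close>.
  Cartan numbers within \<open>Phi1\<close> are nonnegative integers, so their sum is at least 1,
  and the pairing in question is 1 minus this sum.\<close>

lemma Ort_max_inner_nonpos:
  assumes "B \<in> Ort_max Phi1" "\<gamma> \<in> Phi1"
  shows "set_reflection B \<omega> \<bullet> \<gamma> \<le> 0"
proof -
  have B: "B \<in> Ort Phi1" using assms by (simp add: Ort_max_def)
  have "\<exists>\<beta>\<in>B. \<gamma> \<bullet> \<beta> \<noteq> 0"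
  proof (rule ccontr)
    assume no: "\<not> ?thesis"
    then have "insert \<gamma> B \<in> Ort Phi1"
      using B assms(2) by (auto simp: Ort_def pairwise_insert orthogonal_def inner_commute)
    then have "\<gamma> \<in> B" using assms(1) by (auto simp: Ort_max_def)
    then show False using no Phi1_nonzero[OF assms(2)] by auto
  qed
  then obtain \<beta> where b: "\<beta> \<in> B" "cartan \<gamma> \<beta> \<noteq> 0"
    using Ort_Phi1(4)[OF B] cartan_eq_0_iff orthogonal_def by metis
  have nonneg: "0 \<le> cartan \<gamma> \<eta>" if "\<eta> \<in> B" for \<eta>
    using cartan_Phi1[OF assms(2), of \<eta>] Ort_Phi1(2)[OF B] that by fastforce
  have "1 \<le> cartan \<gamma> \<beta>"
    using cartan_Phi1[OF assms(2), of \<beta>] Ort_Phi1(2)[OF B] b by fastforce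
  also have "\<dots> \<le> (\<Sum>\<beta>\<in>B. cartan \<gamma> \<beta>)"
    using b nonneg Ort_Phi1(1)[OF B] by (intro member_le_sum) auto
  finally show ?thesis
    using set_reflection_omega_inner[OF Ort_Phi1(2)[OF B], of \<gamma>] assms(2) by (simp add: Phi1_iff)
qed

lemma Ort_max_full:
  assumes "B \<in> Ort_max Phi1" shows "full B"
proof (rule ccontr)
  assume "\<not> full B"
  \<comment> \<open>Instead of moving \<open>B\<close> step by step, take a counterexample
    minimizing the pairing of \<open>ht_vec\<close> with
    \<open>set_reflection C \<omega>\<close>.\<close>
  define Bad where "Bad = {B \<in> Ort_max Phi1. \<not> full B}"
  have "Bad \<subseteq> Pow Phi1" by (auto simp: Bad_def Ort_max_def Ort_def)
  then have "finite Bad" by (rule finite_subset) simp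
  moreover have "Bad \<noteq> {}" using assms \<open>\<not> full B\<close> by (auto simp: Bad_def)
  ultimately obtain C where "is_arg_min (\<lambda>C. ht_vec \<bullet> set_reflection C \<omega>) (\<lambda>C. C \<in> Bad) C"
    using ex_is_arg_min_if_finite[of Bad "\<lambda>C. ht_vec \<bullet> set_reflection C \<omega>"] by blast
  then have C: "C \<in> Ort_max Phi1" "\<not> full C"
    and min: "\<And>D. D \<in> Bad \<Longrightarrow> ht_vec \<bullet> set_reflection C \<omega> \<le> ht_vec \<bullet> set_reflection D \<omega>"
    by (auto simp: is_arg_min_linorder Bad_def)
  define x where "x = set_reflection C \<omega>"
  have CO: "C \<in> Ort Phi1" using C by (simp add: Ort_max_def)
  \<comment> \<open>If \<open>\<gamma>\<close> paired positively with \<open>x\<close>, reflecting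
    \<open>C\<close> in \<open>\<gamma>\<close> would lower the minimized value. The reflected set
    would then be full, and reflecting back would make \<open>C\<close> full.\<close>
  have "x \<bullet> \<gamma> \<le> 0" if g: "\<gamma> \<in> Phi0" for \<gamma>
  proof (rule ccontr)
    assume "\<not> x \<bullet> \<gamma> \<le> 0"
    then have "0 < cartan x \<gamma>"
      using g by (simp add: cartan_pos_iff root_nonzero pos_root Phi0_iff)
    moreover have "0 < ht_vec \<bullet> \<gamma>" using ht_pos[of \<gamma>] g by (auto simp: Phi0_iff)
    ultimately have less: "ht_vec \<bullet> reflection \<gamma> x < ht_vec \<bullet> x"
      by (simp add: reflection_cartan inner_diff_right)
    have l: "\<gamma> \<in> levi" using g by (rule Phi0_levi)
    have "set_reflection (reflection \<gamma> ` C) \<omega> = reflection \<gamma> x"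
      using set_reflection_image[OF orthogonal_transformation_reflection, of \<gamma> C \<omega>]
      by (simp add: reflection_levi_omega[OF l] x_def)
    with less min[of "reflection \<gamma> ` C"] have "full (reflection \<gamma> ` C)"
      using Ort_max_reflection[OF l C(1)] by (auto simp: Bad_def x_def)
    from full_reflection[OF l this] show False using C by (simp add: image_image)
  qed
  moreover have "x \<bullet> \<gamma> \<le> 0" if "\<gamma> \<in> Phi1" for \<gamma>
    using Ort_max_inner_nonpos[OF C(1) that] by (simp add: x_def)
  moreover have "\<beta> \<in> Phi0 \<or> \<beta> \<in> Phi1" if "\<beta> \<in> pos" for \<beta>
    using coefficient_cases[OF pos_root[OF that]] weight_pos[OF q_simple that] that
    by (auto simp: Phi0_iff Phi1_iff pos_root)
  ultimately have "dominant (- x)"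
    unfolding dominant_def inner_minus_left neg_0_le_iff_le by blast
  obtain \<alpha>s where as: "set \<alpha>s = C" "word_product \<alpha>s = set_reflection C"
    using set_reflection_word_product Ort_Phi1[OF CO] by blast
  obtain \<beta>s where bs: "set \<beta>s \<subseteq> \<Phi>" "word_product \<beta>s \<omega> = - \<omega>" using omega_orbit by blast
  \<comment> \<open>By tube type \<open>- \<omega>\<close> lies in the orbit of
    \<open>\<omega>\<close>, hence so does \<open>- x\<close>, its image under
    \<open>set_reflection C\<close>; both \<open>- x\<close> and \<open>\<omega>\<close> are
    dominant.\<close>
  have "- x = word_product (\<alpha>s @ \<beta>s) \<omega>"
    using orthogonal_transformation_linear[OF orthogonal_transformation_word_product, of \<alpha>s]
    by (simp add: word_product_append bs linear_neg as x_def)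
  moreover have "set (\<alpha>s @ \<beta>s) \<subseteq> \<Phi>" using as bs Ort_Phi1(2)[OF CO] by (auto simp: Phi1_iff)
  moreover have "dominant \<omega>" using weight_pos[OF q_simple] by (simp add: dominant_def)
  ultimately have "- x = \<omega>" using dominant_orbit_unique \<open>dominant (- x)\<close> by metis
  then have "x = - \<omega>" by (metis minus_minus)
  then show False using C CO by (auto simp: full_def x_def)
qed

end

section \<open>Antichains\<close>

context hermitian
begin

section \<open>The action of a full set on the Levi roots\<close>

lemma full_subset: "full B \<Longrightarrow> B \<subseteq> Phi1"
  and full_finite: "full B \<Longrightarrow> finite B"
  and full_orthogonal: "full B \<Longrightarrow> \<alpha> \<in> B \<Longrightarrow> \<beta> \<in> B \<Longrightarrow> \<alpha> \<noteq> \<beta> \<Longrightarrow> orthogonal \<alpha> \<beta>"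
  and full_orthogonal_transformation: "full B \<Longrightarrow> orthogonal_transformation (set_reflection B)"
  and full_involution: "full B \<Longrightarrow> set_reflection B (set_reflection B x) = x"
  and full_member: "full B \<Longrightarrow> \<beta> \<in> B \<Longrightarrow> set_reflection B \<beta> = - \<beta>"
  using Ort_Phi1[of B] orthogonal_transformation_set_reflection[of B] set_reflection_member[of B]
    set_reflection_set_reflection[of B]
  by (auto simp: full_def pairwise_def)

lemma full_linear: "full B \<Longrightarrow> linear (set_reflection B)"
  using full_orthogonal_transformation orthogonal_transformation_linear by blast

text \<open>An isometry negating \<open>\<omega>\<close> negates the coefficient at
  \<open>\<alpha>q\<close>, so coefficient 0 is preserved.\<close>

lemma full_levi:
  assumes "full B" "\<gamma> \<in> levi" shows "set_reflection B \<gamma> \<in> levi"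
proof -
  have "\<omega> \<bullet> set_reflection B \<gamma> = - (set_reflection B \<omega> \<bullet> set_reflection B \<gamma>)"
    using assms by (simp add: full_def)
  also have "\<dots> = - (\<omega> \<bullet> \<gamma>)"
    using full_orthogonal_transformation[OF assms(1)] by (simp add: orthogonal_transformation_def)
  finally show ?thesis
    using assms set_reflection_root[of B \<gamma>] by (auto simp: levi_def full_def)
qed

text \<open>The Cartan numbers of \<open>\<gamma>\<close> on \<open>B\<close> lie in {-1, 0, 1} and
  sum to 0. Only one is -1: \<open>\<gamma> + \<alpha>\<close> is in \<open>Phi1\<close>, and
  against the rest of \<open>B\<close> it has the same Cartan numbers as \<open>\<gamma>\<close>,
  which are therefore nonnegative. Hence exactly one is 1.\<close>

lemma full_levi_moved:
  assumes "full B" "\<gamma> \<in> levi" "set_reflection B \<gamma> \<noteq> \<gamma>"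
  obtains \<alpha> \<beta> where "\<alpha> \<in> B" "\<beta> \<in> B" "cartan \<gamma> \<alpha> = -1" "cartan \<gamma> \<beta> = 1"
    "\<And>\<eta>. \<eta> \<in> B - {\<alpha>, \<beta>} \<Longrightarrow> orthogonal \<gamma> \<eta>" "set_reflection B \<gamma> = \<gamma> + \<alpha> - \<beta>"
proof -
  note fin = full_finite[OF assms(1)] and sub = full_subset[OF assms(1)]
  have sum0: "(\<Sum>\<beta>\<in>B. cartan \<gamma> \<beta>) = 0"
    using full_sum_cartan[OF assms(1)] assms(2) by (simp add: levi_def)
  have vals: "cartan \<gamma> \<eta> = -1 \<or> cartan \<gamma> \<eta> = 0 \<or> cartan \<gamma> \<eta> = 1" if "\<eta> \<in> B" for \<eta>
    using cartan_levi[OF assms(2)] sub that by blast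
  have "\<exists>\<alpha>\<in>B. cartan \<gamma> \<alpha> = -1"
  proof (rule ccontr)
    assume no: "\<not> ?thesis"
    then have "\<forall>\<eta>\<in>B. 0 \<le> cartan \<gamma> \<eta>" using vals by fastforce
    then have "\<forall>\<eta>\<in>B. cartan \<gamma> \<eta> = 0" using sum0 fin by (simp add: sum_nonneg_eq_0_iff)
    then have "set_reflection B \<gamma> = \<gamma>" by (simp add: set_reflection_def)
    then show False using assms(3) by simp
  qed
  then obtain \<alpha> where a: "\<alpha> \<in> B" "cartan \<gamma> \<alpha> = -1" by blast
  have ga: "\<gamma> + \<alpha> \<in> Phi1"
    using reflection_root[of \<alpha> \<gamma>] a assms(2) sub
    by (auto simp: Phi1_iff levi_def reflection_cartan inner_add_right)
  have nonneg: "0 \<le> cartan \<gamma> \<eta>" if "\<eta> \<in> B - {\<alpha>}" for \<eta>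
  proof -
    have "cartan (\<gamma> + \<alpha>) \<eta> = cartan \<gamma> \<eta>"
      using cartan_orthogonal full_orthogonal[OF assms(1) a(1)] that by auto
    then show ?thesis using cartan_Phi1[OF ga, of \<eta>] sub that by fastforce
  qed
  have sum1: "(\<Sum>\<eta>\<in>B - {\<alpha>}. cartan \<gamma> \<eta>) = 1"
    using sum0 a fin by (simp add: sum.remove)
  then obtain \<beta> where "\<beta> \<in> B - {\<alpha>}" "cartan \<gamma> \<beta> \<noteq> 0"
    by (metis sum.neutral zero_neq_one)
  then have b: "\<beta> \<in> B - {\<alpha>}" "cartan \<gamma> \<beta> = 1"
    using vals[of \<beta>] nonneg[of \<beta>] by auto
  have sum2: "(\<Sum>\<eta>\<in>B - {\<alpha>} - {\<beta>}. cartan \<gamma> \<eta>) = 0"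
    using sum1 b fin by (simp add: sum.remove[of _ \<beta>])
  then have rest: "cartan \<gamma> \<eta> = 0" if "\<eta> \<in> B - {\<alpha>} - {\<beta>}" for \<eta>
    using nonneg fin that by (subst (asm) sum_nonneg_eq_0_iff) auto
  have "(\<Sum>\<eta>\<in>B. cartan \<gamma> \<eta> *\<^sub>R \<eta>)
      = cartan \<gamma> \<alpha> *\<^sub>R \<alpha> + (cartan \<gamma> \<beta> *\<^sub>R \<beta> + (\<Sum>\<eta>\<in>B - {\<alpha>} - {\<beta>}. cartan \<gamma> \<eta> *\<^sub>R \<eta>))"
    using a b fin by (subst sum.remove[of B \<alpha>]; simp add: sum.remove[of "B - {\<alpha>}" \<beta>])
  then have "set_reflection B \<gamma> = \<gamma> + \<alpha> - \<beta>"
    using a b rest by (simp add: set_reflection_def)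
  moreover have "orthogonal \<gamma> \<eta>" if "\<eta> \<in> B - {\<alpha>, \<beta>}" for \<eta>
    using rest[of \<eta>] that sub Phi1_nonzero by (auto simp: cartan_eq_0_iff subset_iff)
  ultimately show thesis using that a b by blast
qed

text \<open>If the image were negative, the two elements of \<open>A\<close> that
  \<open>\<gamma>\<close> meets would differ by a sum of two roots of \<open>Phi0\<close> and so be
  comparable.\<close>

lemma antichain_preserves_Phi0:
  assumes "full A" "antichain0 \<Phi> \<Delta> \<alpha>q A" "\<gamma> \<in> Phi0"
  shows "set_reflection A \<gamma> \<in> Phi0"
proof (rule ccontr)
  assume no: "set_reflection A \<gamma> \<notin> Phi0"
  then have d: "- set_reflection A \<gamma> \<in> Phi0"
    using levi_cases full_levi[OF assms(1) Phi0_levi[OF assms(3)]] by blast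
  have "set_reflection A \<gamma> \<noteq> \<gamma>" using no assms(3) by auto
  then obtain \<alpha> \<beta> where ab: "\<alpha> \<in> A" "\<beta> \<in> A" "cartan \<gamma> \<alpha> = -1" "cartan \<gamma> \<beta> = 1"
    "set_reflection A \<gamma> = \<gamma> + \<alpha> - \<beta>"
    using full_levi_moved[OF assms(1) Phi0_levi[OF assms(3)]] by metis
  have "\<gamma> + - set_reflection A \<gamma> \<in> cone"
    using nat_combinations_add Phi0_cone d assms(3) by blast
  then have "le0 \<Phi> \<Delta> \<alpha>q \<alpha> \<beta>" by (simp add: le0_def ab)
  then have "\<alpha> = \<beta>" using assms(2) ab by (auto simp: antichain0_def)
  then show False using ab by simp
qed

section \<open>Uniqueness of the antichain\<close>

lemma automorphism_no_shift:
  assumes "linear u" "inj u" "\<And>\<beta>. \<beta> \<in> \<Phi> \<Longrightarrow> u \<beta> \<in> \<Phi>" "\<And>\<gamma>. \<gamma> \<in> Phi0 \<Longrightarrow> u \<gamma> \<in> Phi0"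
    and "\<alpha> \<in> \<Phi>" "u \<alpha> - \<alpha> \<in> cone"
  shows "u \<alpha> = \<alpha>"
proof (rule ccontr)
  assume "u \<alpha> \<noteq> \<alpha>"
  \<comment> \<open>The iterates of \<open>u\<close> carry the nonzero shift to nonzero cone
    elements, so heights increase strictly along the orbit of \<open>\<alpha>\<close>, which lies in
    the finite set \<open>\<Phi>\<close>.\<close>
  have cone: "(u ^^ k) (u \<alpha> - \<alpha>) \<in> cone \<and> (u ^^ k) (u \<alpha> - \<alpha>) \<noteq> 0" for k
  proof (induction k)
    case (Suc k)
    then show ?case
      using nat_combinations_linear_image[OF assms(1), of Phi0 Phi0] assms(4) Phi0_cone
        linear_injective_0[OF assms(1)] assms(2) by auto
  qed (use assms(6) \<open>u \<alpha> \<noteq> \<alpha>\<close> in auto)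
  have lin: "linear (u ^^ k)" for k
    by (induction k) (simp_all add: linear_compose assms(1) linear_ident id_def del: o_apply)
  have "ht_vec \<bullet> (u ^^ k) \<alpha> < ht_vec \<bullet> (u ^^ Suc k) \<alpha>" for k
    using cone_ht[of "(u ^^ k) (u \<alpha> - \<alpha>)"] cone[of k] linear_diff[OF lin[of k], of "u \<alpha>" \<alpha>]
    by (simp add: inner_diff_right funpow_swap1)
  then have "strict_mono (\<lambda>k. ht_vec \<bullet> (u ^^ k) \<alpha>)" by (simp add: strict_mono_Suc_iff)
  then have "inj (\<lambda>k. ht_vec \<bullet> (u ^^ k) \<alpha>)" by (rule strict_mono_imp_inj_on)
  then have "infinite (range (\<lambda>k. ht_vec \<bullet> (u ^^ k) \<alpha>))" by (simp add: finite_image_iff)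
  moreover have "(u ^^ k) \<alpha> \<in> \<Phi>" for k
    by (induction k) (auto simp: assms(3,5))
  then have "range (\<lambda>k. ht_vec \<bullet> (u ^^ k) \<alpha>) \<subseteq> (\<lambda>\<beta>. ht_vec \<bullet> \<beta>) ` \<Phi>" by auto
  ultimately show False using finite_subset finite_imageI finite_roots by blast
qed

text \<open>For an antichain \<open>A\<close> the map \<open>- set_reflection A\<close> is an order-reversing involution of
  \<open>Phi1\<close> fixing \<open>A\<close> pointwise. If \<open>\<alpha> \<in> A - A'\<close>, all elements of \<open>A'\<close> not orthogonal to \<open>\<alpha>\<close> lie
  on the same side of \<open>\<alpha>\<close>, so the involution of \<open>A'\<close> moves \<open>\<alpha>\<close> strictly to that side. The
  composition of the two involutions is then an order automorphism of a finite poset moving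
  \<open>\<alpha>\<close> strictly to the other side, which is impossible.\<close>

lemma antichain_subset:
  assumes A: "full A" "antichain0 \<Phi> \<Delta> \<alpha>q A" and A': "full A'" "antichain0 \<Phi> \<Delta> \<alpha>q A'"
  shows "A \<subseteq> A'"
proof (rule subsetI, rule ccontr)
  fix \<alpha> assume a: "\<alpha> \<in> A" "\<alpha> \<notin> A'"
  define S where "S = {\<beta> \<in> A'. cartan \<alpha> \<beta> \<noteq> 0}"
  have a1: "\<alpha> \<in> Phi1" using a full_subset A by blast
  have S: "\<alpha> - \<beta> \<in> Phi0 \<or> \<beta> - \<alpha> \<in> Phi0" if "\<beta> \<in> S" for \<beta>
  proof -
    have "\<beta> \<in> Phi1" "\<alpha> \<noteq> \<beta>" "\<alpha> \<bullet> \<beta> \<noteq> 0"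
      using that a full_subset[OF A'(1)] by (auto simp: S_def cartan_def)
    then show ?thesis using levi_cases[OF diff_levi[OF a1]] by fastforce
  qed
  have "(\<forall>\<beta>\<in>S. \<alpha> - \<beta> \<in> Phi0) \<or> (\<forall>\<beta>\<in>S. \<beta> - \<alpha> \<in> Phi0)"
  proof (rule ccontr)
    assume "\<not> ?thesis"
    then obtain \<beta>1 \<beta>2 where b: "\<beta>1 \<in> S" "\<beta>1 - \<alpha> \<in> Phi0" "\<beta>2 \<in> S" "\<alpha> - \<beta>2 \<in> Phi0"
      using S by blast
    then have "(\<beta>1 - \<alpha>) + (\<alpha> - \<beta>2) \<in> cone" using nat_combinations_add Phi0_cone by blast
    then have "\<beta>2 = \<beta>1" using A'(2) b by (auto simp: antichain0_def le0_def S_def)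
    then show False using b uminus_notin_Phi0[OF b(2)] by simp
  qed
  \<comment> \<open>The sign merges the two cases: 1 when \<open>\<alpha>\<close> lies above the
    members of \<open>S\<close>, -1 when it lies below.\<close>
  then obtain e :: real where e: "e = 1 \<or> e = -1" "\<And>\<beta>. \<beta> \<in> S \<Longrightarrow> e *\<^sub>R (\<alpha> - \<beta>) \<in> Phi0"
    by (metis minus_diff_eq scaleR_minus1_left scaleR_one)
  define s s' where "s = set_reflection A" and "s' = set_reflection A'"
  have lin: "linear s" "linear s'" using A A' full_linear by (auto simp: s_def s'_def)
  have sum2: "(\<Sum>\<beta>\<in>A'. cartan \<alpha> \<beta>) = 2"
    using full_sum_cartan[OF A'(1), of \<alpha>] a1 by (simp add: Phi1_iff)
  \<comment> \<open>Since the Cartan numbers sum to exactly 2, the term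
    \<open>2 *\<^sub>R \<alpha>\<close> can be distributed over \<open>A'\<close>, leaving only
    differences \<open>\<alpha> - \<beta>\<close>.\<close>
  have "s' \<alpha> + \<alpha> = 2 *\<^sub>R \<alpha> - (\<Sum>\<beta>\<in>A'. cartan \<alpha> \<beta> *\<^sub>R \<beta>)"
    by (simp add: s'_def set_reflection_def scaleR_2)
  also have "\<dots> = (\<Sum>\<beta>\<in>A'. cartan \<alpha> \<beta> *\<^sub>R (\<alpha> - \<beta>))"
    by (simp add: scaleR_diff_right sum_subtractf sum2 flip: scaleR_sum_left)
  finally have shift: "e *\<^sub>R (s' \<alpha> + \<alpha>) = (\<Sum>\<beta>\<in>A'. cartan \<alpha> \<beta> *\<^sub>R (e *\<^sub>R (\<alpha> - \<beta>)))"
    by (simp add: scaleR_sum_right scaleR_left_commute mult.commute)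
  have summand: "cartan \<alpha> \<beta> *\<^sub>R (e *\<^sub>R (\<alpha> - \<beta>)) \<in> cone"
    "cartan \<alpha> \<beta> \<le> ht_vec \<bullet> (cartan \<alpha> \<beta> *\<^sub>R (e *\<^sub>R (\<alpha> - \<beta>)))" if "\<beta> \<in> A'" for \<beta>
  proof -
    have "cartan \<alpha> \<beta> = real 0 \<or> cartan \<alpha> \<beta> = real 1 \<or> cartan \<alpha> \<beta> = real 2"
      using cartan_Phi1[OF a1, of \<beta>] full_subset[OF A'(1)] that by auto
    then obtain n where n: "cartan \<alpha> \<beta> = real n" by blast
    have "n \<noteq> 0 \<Longrightarrow> e *\<^sub>R (\<alpha> - \<beta>) \<in> Phi0" using e(2) that n by (simp add: S_def)
    then show "cartan \<alpha> \<beta> *\<^sub>R (e *\<^sub>R (\<alpha> - \<beta>)) \<in> cone"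
      unfolding n using nat_combinations_nat_scaleR[OF Phi0_cone]
      by (cases "n = 0") (auto simp del: scaleR_scaleR)
    have "real n * 1 \<le> real n * (ht_vec \<bullet> (e *\<^sub>R (\<alpha> - \<beta>)))" if "n \<noteq> 0"
      using \<open>n \<noteq> 0 \<Longrightarrow> e *\<^sub>R (\<alpha> - \<beta>) \<in> Phi0\<close> that ht_pos 
      by (intro mult_left_mono) (auto simp only: Phi0_iff of_nat_0_le_iff)
    then show "cartan \<alpha> \<beta> \<le> ht_vec \<bullet> (cartan \<alpha> \<beta> *\<^sub>R (e *\<^sub>R (\<alpha> - \<beta>)))"
      unfolding n inner_scaleR_right[of _ "real n"] by (cases "n = 0") auto
  qed
  have "e *\<^sub>R (s' \<alpha> + \<alpha>) \<in> cone"
    unfolding shift using summand(1) by (intro nat_combinations_sum)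
  moreover have s0: "s \<gamma> \<in> Phi0" "s' \<gamma> \<in> Phi0" if "\<gamma> \<in> Phi0" for \<gamma>
    using antichain_preserves_Phi0 A A' that by (auto simp: s_def s'_def)
  ultimately have "s (e *\<^sub>R (s' \<alpha> + \<alpha>)) \<in> cone"
    using nat_combinations_linear_image[OF lin(1), of Phi0 Phi0] Phi0_cone by blast
  \<comment> \<open>As \<open>s\<close> negates \<open>\<alpha>\<close>, applying it turns the
    displacement of \<open>\<alpha>\<close> by \<open>- s'\<close> into a displacement by the
    composite of \<open>s\<close> and \<open>s'\<close>.\<close>
  moreover have "s (e *\<^sub>R (s' \<alpha> + \<alpha>)) = s (s' (e *\<^sub>R \<alpha>)) - e *\<^sub>R \<alpha>"
    using lin full_member[OF A(1) a(1)]
    by (simp add: linear_add linear_scale s_def scaleR_diff_right)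
  ultimately have mv: "s (s' (e *\<^sub>R \<alpha>)) - e *\<^sub>R \<alpha> \<in> cone" by simp
  have "s (s' (e *\<^sub>R \<alpha>)) = e *\<^sub>R \<alpha>"
  proof (rule automorphism_no_shift[of "\<lambda>x. s (s' x)"])
    show "linear (\<lambda>x. s (s' x))" using linear_compose[OF lin(2,1)] by (simp add: o_def)
    show "inj (\<lambda>x. s (s' x))"
      using full_involution[OF A(1)] full_involution[OF A'(1)]
      unfolding s_def s'_def
      by (intro inj_on_inverseI[where g = "\<lambda>x. set_reflection A' (set_reflection A x)"]) simp
    show "s (s' \<beta>) \<in> \<Phi>" if "\<beta> \<in> \<Phi>" for \<beta>
      using that A A' set_reflection_root by (simp add: s_def s'_def full_def)
    show "s (s' \<gamma>) \<in> Phi0" if "\<gamma> \<in> Phi0" for \<gamma> using s0 that by blast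
    show "e *\<^sub>R \<alpha> \<in> \<Phi>" using e(1) a1 by (auto simp: Phi1_iff)
  qed (rule mv)
  then have "s (e *\<^sub>R (s' \<alpha> + \<alpha>)) = 0"
    using \<open>s (e *\<^sub>R (s' \<alpha> + \<alpha>)) = s (s' (e *\<^sub>R \<alpha>)) - e *\<^sub>R \<alpha>\<close> by simp
  then have zero: "e *\<^sub>R (s' \<alpha> + \<alpha>) = 0"
    using full_involution[OF A(1)] linear_0[OF lin(1)] unfolding s_def by metis
  \<comment> \<open>Each summand of \<open>shift\<close> has height at least its Cartan number, so
    the vector just shown to be 0 would have height at least 2.\<close>
  have "(\<Sum>\<beta>\<in>A'. cartan \<alpha> \<beta>) \<le> ht_vec \<bullet> (e *\<^sub>R (s' \<alpha> + \<alpha>))"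
    unfolding shift inner_sum_right by (rule sum_mono) (rule summand(2))
  then show False using sum2 unfolding zero by simp
qed

section \<open>Exchanging two members of a full set\<close>

lemma full_exchange_reflection:
  assumes "full B" "\<alpha> \<in> B" "\<beta> \<in> B" "\<gamma> \<in> levi" "\<And>\<eta>. \<eta> \<in> B - {\<alpha>, \<beta>} \<Longrightarrow> orthogonal \<gamma> \<eta>"
  shows "full ((B - {\<alpha>, \<beta>}) \<union> {reflection \<gamma> \<alpha>, reflection \<gamma> \<beta>})"
proof -
  \<comment> \<open>The reflection fixes every member of \<open>B\<close> other than
    \<open>\<alpha>\<close> and \<open>\<beta>\<close>, so the exchange is the image of
    \<open>B\<close> under a Levi reflection.\<close>
  have "reflection \<gamma> ` (B - {\<alpha>, \<beta>}) = (\<lambda>\<eta>. \<eta>) ` (B - {\<alpha>, \<beta>})"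
    using assms(5) by (intro image_cong refl reflection_fix) (simp add: orthogonal_commute)
  moreover have "reflection \<gamma> ` B = reflection \<gamma> ` ((B - {\<alpha>, \<beta>}) \<union> {\<alpha>, \<beta>})"
    using assms by (intro arg_cong[where f = "image _"]) auto
  ultimately have "reflection \<gamma> ` B = (B - {\<alpha>, \<beta>}) \<union> {reflection \<gamma> \<alpha>, reflection \<gamma> \<beta>}"
    by (simp only: image_Un image_insert image_empty image_ident)
  then show ?thesis using full_reflection[OF assms(4,1)] by simp
qed

text \<open>Uses that the short root \<open>\<eta>\<close> has coroot equal to the sum of the coroots of the orthogonal
  long roots \<open>\<alpha>\<close> and \<open>\<beta>\<close>.\<close>

lemma full_exchange_midpoint:
  assumes "full B" "\<alpha> \<in> B" "\<beta> \<in> B" "\<alpha> \<noteq> \<beta>" "\<eta> \<in> Phi1" "\<alpha> + \<beta> = 2 *\<^sub>R \<eta>"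
    and "\<alpha> \<bullet> \<alpha> = 2 * (\<eta> \<bullet> \<eta>)" "\<beta> \<bullet> \<beta> = 2 * (\<eta> \<bullet> \<eta>)"
  shows "full ((B - {\<alpha>, \<beta>}) \<union> {\<eta>})"
proof -
  let ?R = "B - {\<alpha>, \<beta>}"
  note fin = full_finite[OF assms(1)] and sub = full_subset[OF assms(1)]
  have orth: "orthogonal \<eta> \<zeta>" if "\<zeta> \<in> ?R" for \<zeta>
  proof -
    have "(\<alpha> + \<beta>) \<bullet> \<zeta> = 0"
      using that full_orthogonal[OF assms(1)] assms(2,3)
      by (auto simp: inner_add_left orthogonal_def)
    then show ?thesis by (simp add: assms(6) orthogonal_def)
  qed
  have "\<eta> \<notin> ?R" using orth[of \<eta>] Phi1_nonzero[OF assms(5)] by (auto simp: orthogonal_def)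
  have "pairwise orthogonal (?R \<union> {\<eta>})"
    using orth full_orthogonal[OF assms(1)]
    by (auto simp: pairwise_insert orthogonal_commute intro!: pairwiseI)
  then have "?R \<union> {\<eta>} \<in> Ort Phi1" using sub assms(5) by (auto simp: Ort_def)
  moreover have "set_reflection (?R \<union> {\<eta>}) \<omega> = set_reflection B \<omega>"
  proof -
    let ?f = "\<lambda>\<beta>. cartan \<omega> \<beta> *\<^sub>R \<beta>"
    have "?f \<alpha> + ?f \<beta> = (1 / (\<eta> \<bullet> \<eta>)) *\<^sub>R (\<alpha> + \<beta>)"
      using assms(2,3,7,8) sub by (auto simp: cartan_def Phi1_iff subset_iff scaleR_add_right)
    also have "\<dots> = ?f \<eta>" using assms(5,6) by (simp add: cartan_def Phi1_iff)
    finally have mid: "?f \<alpha> + ?f \<beta> = ?f \<eta>" .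
    have "sum ?f B = ?f \<alpha> + (?f \<beta> + sum ?f (B - {\<alpha>} - {\<beta>}))"
      using assms(2,3,4) fin by (simp add: sum.remove[of B \<alpha>] sum.remove[of "B - {\<alpha>}" \<beta>])
    also have "B - {\<alpha>} - {\<beta>} = ?R" by auto
    also have "?f \<alpha> + (?f \<beta> + sum ?f ?R) = sum ?f (?R \<union> {\<eta>})"
      using \<open>\<eta> \<notin> ?R\<close> fin mid by (simp flip: add.assoc)
    finally show ?thesis by (simp add: set_reflection_def)
  qed
  ultimately show ?thesis using assms(1) by (simp add: full_def)
qed

text \<open>Otherwise \<open>set_reflection B\<close> preserves the cone; but it negates the
  difference of two comparable members of \<open>B\<close>, contradicting antisymmetry.\<close>

lemma not_antichain_moved:
  assumes "full B" "\<not> antichain0 \<Phi> \<Delta> \<alpha>q B"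
  shows "\<exists>\<gamma>\<in>Phi0. - set_reflection B \<gamma> \<in> Phi0"
proof (rule ccontr)
  assume no: "\<not> ?thesis"
  then have pres: "set_reflection B \<gamma> \<in> Phi0" if "\<gamma> \<in> Phi0" for \<gamma>
    using that no levi_cases[OF full_levi[OF assms(1) Phi0_levi[OF that]]] by blast
  obtain \<mu> \<nu> where mn: "\<mu> \<in> B" "\<nu> \<in> B" "le0 \<Phi> \<Delta> \<alpha>q \<mu> \<nu>" "\<mu> \<noteq> \<nu>"
    using assms(2) by (auto simp: antichain0_def)
  then have "set_reflection B (\<nu> - \<mu>) \<in> cone"
    using nat_combinations_linear_image[OF full_linear[OF assms(1)], of Phi0 Phi0] pres Phi0_cone
    by (auto simp: le0_def)
  then have "\<mu> - \<nu> \<in> cone"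
    using full_linear[OF assms(1)] full_member[OF assms(1)] mn by (simp add: linear_diff)
  then show False using mn le0_antisym by (auto simp: le0_def)
qed

text \<open>Reflection in \<open>\<gamma>\<close> sends \<open>\<alpha>\<close> to
  \<open>\<alpha> + \<gamma>\<close> or \<open>\<alpha> + 2 *\<^sub>R \<gamma>\<close>, and
  \<open>\<beta>\<close> to \<open>\<alpha> + \<delta>\<close> or
  \<open>\<alpha> + (\<delta> - \<gamma>)\<close>. The condition on
  \<open>\<delta> - \<gamma>\<close> puts the last of these above \<open>\<alpha>\<close>.\<close>

lemma exchange_step:
  assumes B: "full B" "\<alpha> \<in> B" "\<beta> \<in> B" and \<gamma>: "\<gamma> \<in> Phi0" and \<delta>: "\<delta> \<in> Phi0"
    and orth: "\<And>\<eta>. \<eta> \<in> B - {\<alpha>, \<beta>} \<Longrightarrow> orthogonal \<gamma> \<eta>"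
    and \<beta>: "\<beta> = \<alpha> + \<gamma> + \<delta>"
    and ca: "cartan \<alpha> \<gamma> = -1 \<or> cartan \<alpha> \<gamma> = -2"
    and cb: "cartan \<beta> \<gamma> = 1 \<or> cartan \<beta> \<gamma> = 2 \<and> \<delta> - \<gamma> \<in> Phi0"
  shows "\<exists>C. finite C \<and> card C \<le> 2 \<and> (\<forall>c\<in>C. c - \<alpha> \<in> cone \<and> c \<noteq> \<alpha>) \<and> full ((B - {\<alpha>, \<beta>}) \<union> C)"
proof (intro exI conjI ballI)
  let ?C = "{reflection \<gamma> \<alpha>, reflection \<gamma> \<beta>}"
  show "full ((B - {\<alpha>, \<beta>}) \<union> ?C)"
    using full_exchange_reflection[OF B Phi0_levi[OF \<gamma>]] orth by blast
  show "card ?C \<le> 2" by (rule card_insert_le_m1) auto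
  have nz: "\<gamma> \<noteq> 0" "\<delta> \<noteq> 0"
    using \<gamma> \<delta> root_nonzero pos_root by (auto simp: Phi0_iff)
  have "\<gamma> + \<gamma> \<in> cone" using nat_combinations_add Phi0_cone \<gamma> by blast
  then have 1: "reflection \<gamma> \<alpha> - \<alpha> \<in> cone" "reflection \<gamma> \<alpha> \<noteq> \<alpha>"
    using ca Phi0_cone[OF \<gamma>] nz by (auto simp: reflection_cartan scaleR_2)
  have "reflection \<gamma> \<beta> - \<alpha> \<in> Phi0"
    using cb
  proof
    assume "cartan \<beta> \<gamma> = 1"
    then have "reflection \<gamma> \<beta> - \<alpha> = \<delta>" by (simp add: reflection_cartan \<beta>)
    then show ?thesis using \<delta> by simp
  next
    assume "cartan \<beta> \<gamma> = 2 \<and> \<delta> - \<gamma> \<in> Phi0"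
    then show ?thesis by (simp add: reflection_cartan \<beta> scaleR_2)
  qed
  then have 2: "reflection \<gamma> \<beta> - \<alpha> \<in> cone" "reflection \<gamma> \<beta> - \<alpha> \<noteq> 0"
    using Phi0_cone root_nonzero[OF pos_root] Phi0_iff by blast+
  show "c - \<alpha> \<in> cone" "c \<noteq> \<alpha>" if "c \<in> ?C" for c using that 1 2 by auto
qed simp

text \<open>Here \<open>\<beta> = \<alpha> + \<gamma> + \<delta>\<close>. The roots
  \<open>\<gamma>\<close>, \<open>\<delta>\<close> and \<open>\<alpha> + \<gamma>\<close> share one
  squared length \<open>g\<close>, while those of \<open>\<alpha>\<close> and \<open>\<beta>\<close>
  are each \<open>g\<close> or \<open>2 * g\<close>; this pattern selects the exchange.\<close>

lemma exchange_up:
  assumes B: "full B" and na: "\<not> antichain0 \<Phi> \<Delta> \<alpha>q B"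
  shows "\<exists>\<alpha>\<in>B. \<exists>\<beta>\<in>B. \<exists>C. finite C \<and> card C \<le> 2 \<and> (\<forall>c\<in>C. c - \<alpha> \<in> cone \<and> c \<noteq> \<alpha>) \<and>
           full ((B - {\<alpha>, \<beta>}) \<union> C)"
proof -
  obtain \<gamma> where \<gamma>: "\<gamma> \<in> Phi0" and \<delta>': "- set_reflection B \<gamma> \<in> Phi0"
    using not_antichain_moved[OF B na] by blast
  define \<delta> where "\<delta> = - set_reflection B \<gamma>"
  have \<delta>: "\<delta> \<in> Phi0" using \<delta>' by (simp add: \<delta>_def)
  have "set_reflection B \<gamma> \<noteq> \<gamma>" using \<gamma> \<delta>' uminus_notin_Phi0 by metis
  then obtain \<alpha> \<beta> where ab: "\<alpha> \<in> B" "\<beta> \<in> B" and ca: "cartan \<gamma> \<alpha> = -1" and cb: "cartan \<gamma> \<beta> = 1"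
    and orth: "\<And>\<eta>. \<eta> \<in> B - {\<alpha>, \<beta>} \<Longrightarrow> orthogonal \<gamma> \<eta>"
    and s: "set_reflection B \<gamma> = \<gamma> + \<alpha> - \<beta>"
    using full_levi_moved[OF B Phi0_levi[OF \<gamma>]] by metis
  have \<beta>: "\<beta> = \<alpha> + \<gamma> + \<delta>" by (simp add: \<delta>_def s)
  have Phi1: "\<alpha> \<in> Phi1" "\<beta> \<in> Phi1" using ab full_subset[OF B] by auto
  have nz: "\<alpha> \<noteq> 0" "\<beta> \<noteq> 0" "\<gamma> \<noteq> 0" "\<delta> \<noteq> 0"
    using Phi1 Phi1_nonzero \<gamma> \<delta> root_nonzero pos_root by (auto simp: Phi0_iff)
  have "\<alpha> \<noteq> \<beta>" using ca cb by auto
  define a b g where "a = \<alpha> \<bullet> \<alpha>" and "b = \<beta> \<bullet> \<beta>" and "g = \<gamma> \<bullet> \<gamma>"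
  have pos: "0 < a" "0 < b" "0 < g" using nz by (auto simp: a_def b_def g_def)
  have i\<alpha>\<beta>: "\<alpha> \<bullet> \<beta> = 0" using full_orthogonal[OF B ab] \<open>\<alpha> \<noteq> \<beta>\<close> by (simp add: orthogonal_def)
  have i\<gamma>\<alpha>: "\<gamma> \<bullet> \<alpha> = - a / 2" using ca pos by (simp add: cartan_def a_def field_simps)
  have i\<gamma>\<beta>: "\<gamma> \<bullet> \<beta> = b / 2" using cb pos by (simp add: cartan_def b_def field_simps)
  have \<delta>_eq: "\<delta> = \<beta> - \<alpha> - \<gamma>" using \<beta> by simp
  have i\<delta>\<alpha>: "\<delta> \<bullet> \<alpha> = - a / 2"
    by (simp add: \<delta>_eq inner_diff_left i\<gamma>\<alpha> i\<alpha>\<beta> inner_commute[of \<beta>] flip: a_def)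
  have i\<delta>\<beta>: "\<delta> \<bullet> \<beta> = b / 2"
    by (simp add: \<delta>_eq inner_diff_left i\<gamma>\<beta> i\<alpha>\<beta> flip: b_def)
  have i\<gamma>\<delta>: "\<gamma> \<bullet> \<delta> = b / 2 + a / 2 - g"
    by (simp add: \<delta>_eq inner_diff_right i\<gamma>\<alpha> i\<gamma>\<beta> flip: g_def)
  have i\<delta>\<delta>: "\<delta> \<bullet> \<delta> = g"
    using full_orthogonal_transformation[OF B]
    by (simp add: \<delta>_def g_def orthogonal_transformation_def)
  have orth': "orthogonal \<delta> \<eta>" if "\<eta> \<in> B - {\<alpha>, \<beta>}" for \<eta>
    using that orth[OF that] full_orthogonal[OF B] ab
    by (auto simp: \<delta>_eq orthogonal_def inner_diff_left)
  \<comment> \<open>The reflection of \<open>\<gamma>\<close> in \<open>\<alpha>\<close>. Its Cartan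
    numbers with \<open>\<alpha>\<close> and \<open>\<beta>\<close> are the length ratios
    \<open>a / g\<close> and \<open>b / g\<close>, hence 1 or 2.\<close>
  define \<eta> where "\<eta> = \<alpha> + \<gamma>"
  have \<eta>: "\<eta> \<in> Phi1"
    using reflection_root[of \<alpha> \<gamma>] ca Phi1 Phi0_levi[OF \<gamma>]
    by (auto simp: \<eta>_def Phi1_iff levi_def reflection_cartan inner_add_right add.commute)
  have i\<eta>: "\<eta> \<bullet> \<eta> = g" "\<alpha> \<bullet> \<eta> = a / 2" "\<beta> \<bullet> \<eta> = b / 2"
    using i\<gamma>\<alpha> i\<gamma>\<beta> i\<alpha>\<beta>
    by (simp_all add: \<eta>_def inner_add_left inner_add_right inner_commute flip: a_def b_def g_def)
  have "a = g \<or> a = 2 * g"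
    using cartan_Phi1[OF Phi1(1) \<eta>] pos by (auto simp: cartan_def i\<eta> field_simps)
  moreover have "b = g \<or> b = 2 * g"
    using cartan_Phi1[OF Phi1(2) \<eta>] pos by (auto simp: cartan_def i\<eta> field_simps)
  ultimately consider "a = 2 * g" "b = 2 * g" | "b = g" "a = g \<or> a = 2 * g" | "a = g" "b = 2 * g"
    by blast
  then show ?thesis
  proof cases
    case 1
    \<comment> \<open>Here \<open>\<gamma> = \<delta>\<close> and reflection in
      \<open>\<gamma>\<close> merely swaps \<open>\<alpha>\<close> and \<open>\<beta>\<close>; their
      midpoint \<open>\<eta>\<close> replaces both instead.\<close>
    have "(\<gamma> - \<delta>) \<bullet> (\<gamma> - \<delta>) = 0"
      using 1 i\<gamma>\<delta> i\<delta>\<delta>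
      by (simp add: inner_diff_left inner_diff_right inner_commute[of \<delta> \<gamma>] flip: g_def)
    then have "\<alpha> + \<beta> = 2 *\<^sub>R \<eta>" by (simp add: \<beta> \<eta>_def scaleR_2)
    then have "full ((B - {\<alpha>, \<beta>}) \<union> {\<eta>})"
      using full_exchange_midpoint[OF B ab \<open>\<alpha> \<noteq> \<beta>\<close> \<eta>] 1 i\<eta>(1) by (simp add: a_def b_def)
    then show ?thesis
      using ab nz Phi0_cone[OF \<gamma>]
      by (intro bexI[of _ \<alpha>] bexI[of _ \<beta>] exI[of _ "{\<eta>}"]) (auto simp: \<eta>_def)
  next
    case 2
    then have "cartan \<alpha> \<gamma> = -1 \<or> cartan \<alpha> \<gamma> = -2" "cartan \<beta> \<gamma> = 1"
      using i\<gamma>\<alpha> i\<gamma>\<beta> pos by (auto simp: cartan_def inner_commute[of \<alpha> \<gamma>] inner_commute[of \<beta> \<gamma>] simp flip: g_def)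
    then show ?thesis using exchange_step[OF B ab \<gamma> \<delta> orth \<beta>] ab by blast
  next
    case 3
    \<comment> \<open>Now \<open>\<gamma>\<close> and \<open>\<delta>\<close> play symmetric parts
      and differ by a Levi root; reflecting in the lower of the two raises both images above
      \<open>\<alpha>\<close>.\<close>
    have c: "cartan \<alpha> \<gamma> = -1" "cartan \<beta> \<gamma> = 2" "cartan \<alpha> \<delta> = -1" "cartan \<beta> \<delta> = 2" "cartan \<delta> \<gamma> = 1"
      using i\<gamma>\<alpha> i\<gamma>\<beta> i\<delta>\<alpha> i\<delta>\<beta> i\<gamma>\<delta> i\<delta>\<delta> 3 pos
      by (simp_all add: cartan_def inner_commute[of \<alpha> \<gamma>] inner_commute[of \<beta> \<gamma>]
          inner_commute[of \<alpha> \<delta>] inner_commute[of \<beta> \<delta>] inner_commute[of \<delta> \<gamma>] flip: g_def)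
    then have "\<delta> - \<gamma> \<in> levi"
      using reflection_root[of \<gamma> \<delta>] Phi0_levi[OF \<gamma>] Phi0_levi[OF \<delta>]
      by (auto simp: reflection_cartan levi_def inner_diff_right)
    then consider "\<delta> - \<gamma> \<in> Phi0" | "\<gamma> - \<delta> \<in> Phi0" using levi_cases by fastforce
    then have "\<exists>C. finite C \<and> card C \<le> 2 \<and> (\<forall>c\<in>C. c - \<alpha> \<in> cone \<and> c \<noteq> \<alpha>) \<and>
        full ((B - {\<alpha>, \<beta>}) \<union> C)"
    proof cases
      case 1
      then show ?thesis using exchange_step[OF B ab \<gamma> \<delta> orth \<beta>] c by simp
    next
      case 2
      have "\<beta> = \<alpha> + \<delta> + \<gamma>" using \<beta> by simp
      then show ?thesis using exchange_step[OF B ab \<delta> \<gamma> orth'] c 2 by simp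
    qed
    then show ?thesis using ab by blast
  qed
qed

section \<open>Termination of the exchanges\<close>

lemma ort_entails_trans:
  "ort_entails \<Phi> \<Delta> \<alpha>q A B \<Longrightarrow> ort_entails \<Phi> \<Delta> \<alpha>q B C \<Longrightarrow> ort_entails \<Phi> \<Delta> \<alpha>q A C"
  using le0_trans unfolding ort_entails_def by meson

lemma antichain_entails:
  assumes "full B"
  shows "\<exists>A. full A \<and> antichain0 \<Phi> \<Delta> \<alpha>q A \<and> ort_entails \<Phi> \<Delta> \<alpha>q A B"
proof -
  \<comment> \<open>The at most two new roots are each at least one higher than the removed
    \<open>\<alpha>\<close>, so together they weigh at most 2/3 of it. Any base above 2 would make
    this potential decrease.\<close>
  define m where "m = (\<lambda>D. \<Sum>\<beta>\<in>D. 3 powr - (ht_vec \<bullet> \<beta>))"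
  define F where "F = {D. full D \<and> ort_entails \<Phi> \<Delta> \<alpha>q D B}"
  have "F \<subseteq> Pow Phi1" using full_subset by (auto simp: F_def)
  then have "finite F" by (rule finite_subset) simp
  moreover have "B \<in> F" using assms by (auto simp: F_def ort_entails_def intro: le0_refl)
  ultimately obtain A where "is_arg_min m (\<lambda>D. D \<in> F) A"
    using ex_is_arg_min_if_finite[of F m] by blast
  then have A: "full A" "ort_entails \<Phi> \<Delta> \<alpha>q A B" and min: "\<And>D. D \<in> F \<Longrightarrow> m A \<le> m D"
    by (auto simp: is_arg_min_linorder F_def)
  have "antichain0 \<Phi> \<Delta> \<alpha>q A"
  proof (rule ccontr)
    assume "\<not> ?thesis"
    then obtain \<alpha> \<beta> C where ab: "\<alpha> \<in> A" "\<beta> \<in> A" and C: "finite C" "card C \<le> 2"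
      "\<And>c. c \<in> C \<Longrightarrow> c - \<alpha> \<in> cone" "\<And>c. c \<in> C \<Longrightarrow> c \<noteq> \<alpha>" and D: "full ((A - {\<alpha>, \<beta>}) \<union> C)"
      using exchange_up[OF A(1)] by metis
    let ?R = "A - {\<alpha>, \<beta>}"
    have finR: "finite ?R" using full_finite[OF A(1)] by simp
    have "\<exists>\<nu>\<in>A. le0 \<Phi> \<Delta> \<alpha>q \<nu> \<mu>" if "\<mu> \<in> ?R \<union> C" for \<mu>
    proof (cases "\<mu> \<in> C")
      case True
      then show ?thesis using C(3) ab by (auto simp: le0_def)
    next
      case False
      then have "\<mu> \<in> A" using that by simp
      then show ?thesis using le0_refl by blast
    qed
    then have "ort_entails \<Phi> \<Delta> \<alpha>q (?R \<union> C) A" by (simp add: ort_entails_def)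
    then have "?R \<union> C \<in> F" using D A(2) ort_entails_trans by (auto simp: F_def)
    then have "m A \<le> m (?R \<union> C)" by (rule min)
    \<comment> \<open>The sets \<open>?R\<close> and \<open>C\<close> may overlap; counting the
      overlap twice only enlarges the upper bound.\<close>
    also have "\<dots> \<le> m (?R \<union> C) + m (?R \<inter> C)" by (simp add: m_def sum_nonneg)
    also have "\<dots> = m ?R + m C" unfolding m_def by (rule sum.union_inter[OF finR C(1)])
    also have "m C \<le> real (card C) * (3 powr - (ht_vec \<bullet> \<alpha> + 1))"
      unfolding m_def
    proof (rule sum_bounded_above)
      fix c assume "c \<in> C"
      then have "1 \<le> ht_vec \<bullet> (c - \<alpha>)" using cone_ht C by simp
      then show "3 powr - (ht_vec \<bullet> c) \<le> 3 powr - (ht_vec \<bullet> \<alpha> + 1)"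
        by (simp add: inner_diff_right)
    qed
    also have "\<dots> \<le> 2 * (3 powr - (ht_vec \<bullet> \<alpha> + 1))"
      using C(2) by (intro mult_right_mono) auto
    also have "\<dots> = 2 / 3 * 3 powr - (ht_vec \<bullet> \<alpha>)"
      by (simp add: powr_diff)
    also have "\<dots> < 3 powr - (ht_vec \<bullet> \<alpha>)" by simp
    finally have "m A < m ?R + m {\<alpha>}" by (simp add: m_def)
    also have "\<dots> = m (?R \<union> {\<alpha>})" using finR by (simp add: m_def)
    also have "\<dots> \<le> m A"
      using ab full_finite[OF A(1)] unfolding m_def by (intro sum_mono2) auto
    finally show False by simp
  qed
  then show ?thesis using A by blast
qed

end

theorem proposition4p12:
  fixes \<Phi> \<Delta> :: "'a::euclidean_space set" and \<alpha>q :: 'a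
  assumes "irreducible_root_system \<Phi>"
    and "hermitian_pair \<Phi> \<Delta> \<alpha>q"
    and "tube_type \<Phi> \<Delta> \<alpha>q"
  shows "\<exists>A. (A \<in> Ort_max (Phi1_pos \<Phi> \<Delta> \<alpha>q) \<and> antichain0 \<Phi> \<Delta> \<alpha>q A) \<and>
             (\<forall>A'. A' \<in> Ort_max (Phi1_pos \<Phi> \<Delta> \<alpha>q) \<and> antichain0 \<Phi> \<Delta> \<alpha>q A' \<longrightarrow> A' = A) \<and>
             (\<forall>B \<in> Ort_max (Phi1_pos \<Phi> \<Delta> \<alpha>q). ort_entails \<Phi> \<Delta> \<alpha>q A B)"
proof -
  interpret hermitian_tube \<Phi> \<Delta> \<alpha>q
    using assms by unfold_locales (auto simp: irreducible_root_system_def hermitian_pair_def)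
  have "Ort Phi1 \<subseteq> Pow Phi1" by (auto simp: Ort_def)
  then have "finite (Ort Phi1)" by (rule finite_subset) simp
  moreover have "{} \<in> Ort Phi1" by (simp add: Ort_def)
  ultimately obtain B where "B \<in> Ort_max Phi1"
    using finite_has_maximal2[of "Ort Phi1" "{}"] by (auto simp: Ort_max_def)
  then obtain A where A: "full A" "antichain0 \<Phi> \<Delta> \<alpha>q A"
    using antichain_entails Ort_max_full by blast
  have unique: "A' = A" if "full A'" "antichain0 \<Phi> \<Delta> \<alpha>q A'" for A'
    using antichain_subset A that by blast
  show ?thesis
  proof (intro exI conjI ballI allI impI)
    show "A \<in> Ort_max Phi1" using full_Ort_max A by blast
    show "antichain0 \<Phi> \<Delta> \<alpha>q A" by (rule A)
    show "A' = A" if "A' \<in> Ort_max Phi1 \<and> antichain0 \<Phi> \<Delta> \<alpha>q A'" for A'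
      using that unique Ort_max_full by blast
    \<comment> \<open>Whatever \<open>B\<close> the exchanges start from, uniqueness identifies the
      antichain they reach with \<open>A\<close>.\<close>
    show "ort_entails \<Phi> \<Delta> \<alpha>q A B" if "B \<in> Ort_max Phi1" for B
      using antichain_entails[OF Ort_max_full[OF that]] unique by blast
  qed
qed

end
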